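(* Let $\mathbf{X}\in\mathbb{R}^{n\times p}$ be a fixed matrix of full column rank $p<n$, let $\mathbf{y}\in\mathbb{R}^n$ be a fixed vector with $SSR_F>0$, let $k>p$, and let $\mathbf{S}$ be a $k\times n$ Gaussian sketching matrix. Then, under the randomness of $\mathbf{S}$ alone: (i) $$\frac{(\boldsymbol{\beta}_s-\boldsymbol{\beta}_F)^{\mathsf T}(\mathbf{X}_s^{\mathsf T}\mathbf{X}_s)(\boldsymbol{\beta}_s-\boldsymbol{\beta}_F)}{SSR_F/k}\sim\chi^2_p;$$ (ii) $$\frac{(\boldsymbol{\beta}_s-\boldsymbol{\beta}_F)^{\mathsf T}(\mathbf{X}_s^{\mathsf T}\mathbf{X}_s)(\boldsymbol{\beta}_s-\boldsymbol{\beta}_F)/p}{SSR_s/(k-p)}\sim F_{p,k-p};$$ (iii) for every $j\in\{1,\dots,p\}$, $$(\boldsymbol{\beta}_{sj}-\boldsymbol{\beta}_{Fj})\left\{\frac{SSR_s}{k-p}\left[(\mathbf{X}_s^{\mathsf T}\mathbf{X}_s)^{-1}\right]_{jj}\right\}^{-1/2}\sim t_{k-p}.$$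
   Context: A Gaussian sketching matrix $\mathbf{S}$ of size $k\times n$ has independent entries $\mathbf{S}_{ij}\sim N(0,1/k)$. The sketched data are $\mathbf{X}_s=\mathbf{S}\mathbf{X}$ and $\mathbf{y}_s=\mathbf{S}\mathbf{y}$. The full-data least squares estimate is $\boldsymbol{\beta}_F=(\mathbf{X}^{\mathsf T}\mathbf{X})^{-1}\mathbf{X}^{\mathsf T}\mathbf{y}$ and the complete sketch estimator is $\boldsymbol{\beta}_s=(\mathbf{X}_s^{\mathsf T}\mathbf{X}_s)^{-1}\mathbf{X}_s^{\mathsf T}\mathbf{y}_s$ (defined almost surely); $\boldsymbol{\beta}_{Fj},\boldsymbol{\beta}_{sj}$ are their $j$-th entries. The residual sums of squares are $SSR_F=\mathbf{y}^{\mathsf T}\{\mathbf{I}-\mathbf{X}(\mathbf{X}^{\mathsf T}\mathbf{X})^{-1}\mathbf{X}^{\mathsf T}\}\mathbf{y}$ and $SSR_s=\mathbf{y}_s^{\mathsf T}\{\mathbf{I}-\mathbf{X}_s(\mathbf{X}_s^{\mathsf T}\mathbf{X}_s)^{-1}\mathbf{X}_s^{\mathsf T}\}\mathbf{y}_s$. $F_{a,b}$ and $t_b$ denote the $F$ and Student $t$ distributions. *)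

theory Defs
  imports "HOL-Probability.Probability"
begin

definition chi_square_distribution :: "nat \<Rightarrow> real measure" where
  "chi_square_distribution d =
     distr (Pi\<^sub>M {..<d} (\<lambda>_. std_normal_distribution)) borel (\<lambda>z. \<Sum>i<d. (z i)\<^sup>2)"

definition F_distribution :: "nat \<Rightarrow> nat \<Rightarrow> real measure" where
  "F_distribution a b =
     distr (chi_square_distribution a \<Otimes>\<^sub>M chi_square_distribution b) borel
       (\<lambda>(u, v). (u / real a) / (v / real b))"

definition t_distribution :: "nat \<Rightarrow> real measure" where
  "t_distribution b =
     distr (std_normal_distribution \<Otimes>\<^sub>M chi_square_distribution b) borel
       (\<lambda>(z, v). z / sqrt (v / real b))"

text \<open>Measurability is demanded explicitly because \<^const>\<open>distr\<close> carries no information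
  for a non-measurable function.\<close>

definition has_law :: "'w measure \<Rightarrow> ('w \<Rightarrow> real) \<Rightarrow> real measure \<Rightarrow> bool" where
  "has_law M Q D \<longleftrightarrow> Q \<in> borel_measurable M \<and> distr M borel Q = D"

text \<open>The variance of each entry is \<open>1/k\<close>; the second argument of
  \<^const>\<open>normal_density\<close> is the standard deviation.\<close>

definition gaussian_sketch :: "'w measure \<Rightarrow> ('w \<Rightarrow> real ^ 'n ^ 'k) \<Rightarrow> bool" where
  "gaussian_sketch M S \<longleftrightarrow>
     prob_space M \<and>
     prob_space.indep_vars M (\<lambda>_. borel) (\<lambda>(i, j) \<omega>. S \<omega> $ i $ j) (UNIV :: ('k \<times> 'n) set) \<and>
     (\<forall>i j. distributed M lborel (\<lambda>\<omega>. S \<omega> $ i $ j)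
        (normal_density 0 (sqrt (1 / real CARD('k)))))"

text \<open>For a singular argument \<^const>\<open>matrix_inv\<close> returns one fixed unspecified matrix. This only
  affects the sketched quantities below on a null event.\<close>

definition least_squares :: "real ^ 'p ^ 'm \<Rightarrow> real ^ 'm \<Rightarrow> real ^ 'p" where
  "least_squares X y = (matrix_inv (transpose X ** X) ** transpose X) *v y"

definition SSR :: "real ^ 'p ^ 'm \<Rightarrow> real ^ 'm \<Rightarrow> real" where
  "SSR X y = y \<bullet> ((mat 1 - X ** matrix_inv (transpose X ** X) ** transpose X) *v y)"

lemma prob_space_chi_square_distribution: "prob_space (chi_square_distribution d)"
proof -
  interpret N: prob_space std_normal_distribution
    by (rule prob_space_normal_density) simp
  have "prob_space (Pi\<^sub>M {..<d} (\<lambda>_. std_normal_distribution))"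
    by (intro prob_space_PiM N.prob_space_axioms)
  then show ?thesis
    unfolding chi_square_distribution_def by (rule prob_space.prob_space_distr) measurable
qed

end

theory Submission
  imports Defs
begin

text \<open>Let \<open>r = y - X \<beta>F\<close>, so that \<open>X\<^sup>T r = 0\<close>, \<open>SSRF = |r|\<^sup>2\<close> and \<open>ys = Xs \<beta>F + S r\<close>. The law of \<open>S\<close>, a
  multiple of the standard Gaussian on the space of matrices, has independent standard normal
  coordinates in every orthonormal basis. A basis that begins with the matrices \<open>b r\<^sup>T / |r|\<close> (\<open>b\<close> a
  standard basis vector) shows that \<open>S r\<close> depends only on the coordinates along these and \<open>S X\<close> only on
  the others, so that \<open>S r\<close> and \<open>S X\<close> are independent. For a fixed value \<open>A\<close> of \<open>S X\<close> of full rank,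
  which happens almost surely, a second orthonormal basis, adapted to the range of \<open>A\<close> and its
  complement, turns the numerators into sums of squares of independent normal coordinates.
  The resulting laws do not depend on \<open>A\<close>, and Fubini finishes the proof.\<close>

section \<open>Standard Gaussian measures on Euclidean spaces\<close>

lemma nn_integral_lborel_translate:
  fixes c :: "'a::euclidean_space"
  assumes [measurable]: "h \<in> borel_measurable borel"
  shows "(\<integral>\<^sup>+x. h (c + x) \<partial>lborel) = (\<integral>\<^sup>+x. h x \<partial>lborel)"
  by (subst (2) lborel_distr_plus[of c, symmetric], subst nn_integral_distr) auto

text \<open>Both sides are multiplied by the volume of the unit ball, which is invariant under the map;
  then Fubini and translation invariance exchange the roles of the set and the ball.\<close>

lemma lborel_distr_orthogonal:
  fixes f :: "'a::euclidean_space \<Rightarrow> 'a"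
  assumes f: "orthogonal_transformation f"
  shows "distr lborel borel f = lborel"
proof (rule measure_eqI)
  have lin: "linear f" and nrm: "\<And>x. norm (f x) = norm x"
    using f by (auto simp: orthogonal_transformation)
  have [measurable]: "f \<in> borel_measurable borel"
    by (intro borel_measurable_continuous_onI linear_continuous_on linear_conv_bounded_linear[THEN iffD1] lin)
  obtain g where g: "\<And>x. f (g x) = x"
    using orthogonal_transformation_surj[OF f] unfolding surj_def by metis
  fix A assume "A \<in> sets (distr lborel borel f)"
  then have A[measurable]: "A \<in> sets borel" by simp
  define B :: "'a set" where "B = ball 0 1"
  have B[measurable]: "B \<in> sets borel" by (simp add: B_def)
  have "emeasure lborel B = ennreal (measure lborel B)" "measure lborel B > 0"
    using emeasure_lborel_ball_finite[of "0::'a" 1] content_ball_pos[of 1 "0::'a"]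
    by (auto simp: B_def emeasure_eq_ennreal_measure less_top)
  then have B0: "emeasure lborel B \<noteq> 0" "emeasure lborel B \<noteq> \<infinity>"
    by auto
  have Bt: "(\<integral>\<^sup>+y. indicator B (c + y) \<partial>lborel) = emeasure lborel B" for c
    by (subst nn_integral_lborel_translate) auto
  have "emeasure (distr lborel borel f) A * emeasure lborel B
      = (\<integral>\<^sup>+x. indicator A (f x) \<partial>lborel) * emeasure lborel B"
    by (simp add: nn_integral_indicator[symmetric] nn_integral_distr del: nn_integral_indicator)
  also have "\<dots> = (\<integral>\<^sup>+x. indicator A (f x) * (\<integral>\<^sup>+y. indicator B (- f x + y) \<partial>lborel) \<partial>lborel)"
    by (subst nn_integral_multc[symmetric]) (measurable, simp only: Bt)
  also have "\<dots> = (\<integral>\<^sup>+x. \<integral>\<^sup>+y. indicator A (f x) * indicator B (- f x + y) \<partial>lborel \<partial>lborel)"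
    by (subst nn_integral_cmult) auto
  also have "\<dots> = (\<integral>\<^sup>+y. \<integral>\<^sup>+x. indicator A (f x) * indicator B (- f x + y) \<partial>lborel \<partial>lborel)"
    by (rule lborel_pair.Fubini'[symmetric]) measurable
  \<comment> \<open>Here \<open>g\<close> is a right inverse of \<open>f\<close>. Shifting
    \<open>x\<close> by \<open>g y\<close> turns \<open>f x\<close> into \<open>y + f x\<close>, so
    \<open>A\<close> is now tested at a translate and the ball at \<open>- f x\<close>; the ball is
    symmetric, which removes the sign.\<close>
  also have "\<dots> = (\<integral>\<^sup>+y. \<integral>\<^sup>+x. indicator A (f (g y + x)) * indicator B (- f (g y + x) + y) \<partial>lborel \<partial>lborel)"
    by (intro nn_integral_cong nn_integral_lborel_translate[symmetric]) measurable
  also have "\<dots> = (\<integral>\<^sup>+y. \<integral>\<^sup>+x. indicator B (f x) * indicator A (f x + y) \<partial>lborel \<partial>lborel)"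
    by (intro nn_integral_cong)
      (simp add: linear_add[OF lin] g B_def dist_norm nrm indicator_def ac_simps)
  also have "\<dots> = (\<integral>\<^sup>+x. \<integral>\<^sup>+y. indicator B (f x) * indicator A (f x + y) \<partial>lborel \<partial>lborel)"
    by (rule lborel_pair.Fubini') measurable
  also have "\<dots> = (\<integral>\<^sup>+x. indicator B (f x) \<partial>lborel) * emeasure lborel A"
    by (simp add: nn_integral_cmult nn_integral_lborel_translate nn_integral_multc)
  also have "(\<lambda>x. indicator B (f x)) = (indicator B :: _ \<Rightarrow> ennreal)"
    by (auto simp: B_def indicator_def nrm fun_eq_iff)
  finally have "emeasure lborel B * emeasure (distr lborel borel f) A = emeasure lborel B * emeasure lborel A"
    by (simp add: mult.commute)
  then show "emeasure (distr lborel borel f) A = emeasure lborel A"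
    using B0 by (simp add: ennreal_mult_cancel_left)
qed simp

text \<open>The standard Gaussian law on an arbitrary Euclidean space, matrices included. It is
  built along \<open>Basis\<close>; that any orthonormal basis gives the same measure is proved
  further down.\<close>

definition std_gaussian :: "'a::euclidean_space measure" where
  "std_gaussian = distr (\<Pi>\<^sub>M b\<in>Basis. std_normal_distribution) borel (\<lambda>f. \<Sum>b\<in>Basis. f b *\<^sub>R b)"

lemma sets_std_gaussian[simp, measurable_cong]: "sets std_gaussian = sets borel"
  and space_std_gaussian[simp]: "space std_gaussian = UNIV"
  by (auto simp: std_gaussian_def)

lemma prob_space_std_normal: "prob_space std_normal_distribution"
  by (rule prob_space_normal_density) simp

lemma product_prob_space_std_normal: "product_prob_space (\<lambda>_. std_normal_distribution)"
  by (intro product_prob_spaceI prob_space_std_normal)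

lemma prob_space_PiM_std_normal: "prob_space (\<Pi>\<^sub>M i\<in>I. std_normal_distribution)"
  by (intro prob_space_PiM prob_space_std_normal)

lemma measurable_sum_scaleR_PiM:
  fixes v :: "'i \<Rightarrow> 'a::euclidean_space"
  shows "(\<lambda>f. \<Sum>i\<in>I. f i *\<^sub>R v i) \<in> borel_measurable (\<Pi>\<^sub>M i\<in>I. std_normal_distribution)"
  by measurable

text \<open>A product measure is determined by its values on boxes. On a box the indicator is a
  product over the coordinates, so the integrand has separated variables and the integral
  factors.\<close>

lemma PiM_density_lborel:
  assumes I: "finite I" and g[measurable]: "g \<in> borel_measurable borel"
    and p: "prob_space (density lborel g)"
  shows "(\<Pi>\<^sub>M i\<in>I. density (lborel :: real measure) g)
      = density (\<Pi>\<^sub>M i\<in>I. lborel) (\<lambda>x. \<Prod>i\<in>I. g (x i))"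
proof -
  interpret G: product_prob_space "\<lambda>_. density (lborel :: real measure) g"
    by (intro product_prob_spaceI p)
  interpret L: product_sigma_finite "\<lambda>_. lborel :: real measure"
    by unfold_locales
  show ?thesis
  proof (rule G.PiM_eqI[symmetric, OF I])
    show "sets (density (\<Pi>\<^sub>M i\<in>I. lborel) (\<lambda>x. \<Prod>i\<in>I. g (x i))) = sets (\<Pi>\<^sub>M i\<in>I. density lborel g)"
      by (simp cong: sets_PiM_cong)
    fix A assume "\<And>i. i \<in> I \<Longrightarrow> A i \<in> sets (density lborel g)"
    then have A[measurable]: "\<And>i. i \<in> I \<Longrightarrow> A i \<in> sets borel" by simp
    have "emeasure (density (\<Pi>\<^sub>M i\<in>I. lborel) (\<lambda>x. \<Prod>i\<in>I. g (x i))) (Pi\<^sub>E I A)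
        = (\<integral>\<^sup>+x. (\<Prod>i\<in>I. g (x i)) * indicator (Pi\<^sub>E I A) x \<partial>(\<Pi>\<^sub>M i\<in>I. lborel))"
      using I A by (subst emeasure_density) (auto intro!: sets_PiM_I_finite)
    also have "\<dots> = (\<integral>\<^sup>+x. (\<Prod>i\<in>I. g (x i) * indicator (A i) (x i)) \<partial>(\<Pi>\<^sub>M i\<in>I. lborel))"
    proof (intro nn_integral_cong)
      fix x :: "'a \<Rightarrow> real" assume "x \<in> space (\<Pi>\<^sub>M i\<in>I. lborel)"
      then have "indicator (Pi\<^sub>E I A) x = (\<Prod>i\<in>I. indicator (A i) (x i) :: ennreal)"
        using I by (auto simp: indicator_def space_PiM PiE_iff)
      then show "(\<Prod>i\<in>I. g (x i)) * indicator (Pi\<^sub>E I A) x = (\<Prod>i\<in>I. g (x i) * indicator (A i) (x i))"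
        by (simp add: prod.distrib)
    qed
    also have "\<dots> = (\<Prod>i\<in>I. \<integral>\<^sup>+x. g x * indicator (A i) x \<partial>lborel)"
      using I by (intro L.product_nn_integral_prod) auto
    also have "\<dots> = (\<Prod>i\<in>I. emeasure (density lborel g) (A i))"
      by (intro prod.cong refl) (simp add: emeasure_density)
    finally show "emeasure (density (\<Pi>\<^sub>M i\<in>I. lborel) (\<lambda>x. \<Prod>i\<in>I. g (x i))) (Pi\<^sub>E I A)
        = (\<Prod>i\<in>I. emeasure (density lborel g) (A i))" .
  qed
qed

text \<open>Multiplying the one-dimensional densities leaves a function of the norm alone; this is
  what makes the measure invariant under orthogonal maps.\<close>

lemma std_gaussian_density:
  "(std_gaussian :: 'a::euclidean_space measure)
    = density lborel (\<lambda>x. ennreal ((1 / sqrt (2 * pi)) ^ DIM('a) * exp (- (norm x)\<^sup>2 / 2)))"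
proof -
  let ?P = "\<Pi>\<^sub>M b\<in>(Basis::'a set). (lborel :: real measure)"
  have eq: "(\<Prod>b\<in>Basis. ennreal (std_normal_density (x \<bullet> b)))
      = ennreal ((1 / sqrt (2 * pi)) ^ DIM('a) * exp (- (norm x)\<^sup>2 / 2))" for x :: 'a
  proof -
    have "(norm x)\<^sup>2 = (\<Sum>b\<in>Basis. (x \<bullet> b)\<^sup>2)"
      unfolding power2_norm_eq_inner by (subst euclidean_inner) (simp only: power2_eq_square)
    then have "- (norm x)\<^sup>2 / 2 = (\<Sum>b\<in>Basis. - (x \<bullet> b)\<^sup>2 / 2)"
      unfolding sum_divide_distrib[symmetric] sum_negf by (rule arg_cong)
    then have "(\<Prod>b\<in>Basis. exp (- (x \<bullet> b)\<^sup>2 / 2)) = exp (- (norm x)\<^sup>2 / 2)"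
      by (simp only: exp_sum[OF finite_Basis])
    then have "(\<Prod>b\<in>Basis. std_normal_density (x \<bullet> b)) = (1 / sqrt (2 * pi)) ^ DIM('a) * exp (- (norm x)\<^sup>2 / 2)"
      unfolding std_normal_density_def prod.distrib prod_constant by (rule arg_cong)
    then show ?thesis
      using prod_ennreal[of Basis "\<lambda>b. std_normal_density (x \<bullet> b)"] by (metis normal_density_nonneg)
  qed
  have "(std_gaussian :: 'a measure)
      = distr (density ?P (\<lambda>f. \<Prod>b\<in>Basis. ennreal (std_normal_density (f b)))) borel (\<lambda>f. \<Sum>b\<in>Basis. f b *\<^sub>R b)"
    unfolding std_gaussian_def by (subst PiM_density_lborel) (auto intro: prob_space_std_normal)
  \<comment> \<open>Each coordinate \<open>f b\<close> is read off from the vector it builds, so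
    that the density becomes a function of the image point and can be pulled through
    \<open>distr\<close>.\<close>
  also have "\<dots> = distr (density ?P (\<lambda>f. \<Prod>b\<in>Basis. ennreal (std_normal_density ((\<Sum>b\<in>Basis. f b *\<^sub>R b) \<bullet> b))))
      borel (\<lambda>f. \<Sum>b\<in>Basis. f b *\<^sub>R b)"
    by (simp add: inner_sum_left_Basis cong: prod.cong)
  also have "\<dots> = density (distr ?P borel (\<lambda>f. \<Sum>b\<in>Basis. f b *\<^sub>R b)) (\<lambda>x. \<Prod>b\<in>Basis. ennreal (std_normal_density (x \<bullet> b)))"
    by (rule density_distr[symmetric]) measurable
  also have "distr ?P borel (\<lambda>f. \<Sum>b\<in>Basis. f b *\<^sub>R b) = lborel"
    by (rule lborel_eq[symmetric])
  finally show ?thesis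
    by (simp only: eq)
qed

text \<open>Lebesgue measure and the density, which sees only the norm, are both invariant under
  \<open>f\<close>.\<close>

lemma std_gaussian_distr_orthogonal:
  fixes f :: "'a::euclidean_space \<Rightarrow> 'a"
  assumes f: "orthogonal_transformation f"
  shows "distr std_gaussian borel f = std_gaussian"
proof -
  let ?d = "\<lambda>x::'a. ennreal ((1 / sqrt (2 * pi)) ^ DIM('a) * exp (- (norm x)\<^sup>2 / 2))"
  have lin: "linear f" and nrm: "\<And>x. norm (f x) = norm x"
    using f by (auto simp: orthogonal_transformation)
  have [measurable]: "f \<in> borel_measurable borel"
    by (intro borel_measurable_continuous_onI linear_continuous_on linear_conv_bounded_linear[THEN iffD1] lin)
  have "distr std_gaussian borel f = distr (density lborel (\<lambda>x. ?d (f x))) borel f"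
    by (simp add: std_gaussian_density nrm)
  also have "\<dots> = density (distr lborel borel f) ?d"
    by (rule density_distr[symmetric]) auto
  also have "\<dots> = std_gaussian"
    by (simp add: lborel_distr_orthogonal[OF f] std_gaussian_density)
  finally show ?thesis .
qed

section \<open>Orthonormal systems and the coordinates of a standard Gaussian along them\<close>

definition orthonormal :: "'a::real_inner set \<Rightarrow> bool" where
  "orthonormal C \<longleftrightarrow> pairwise orthogonal C \<and> (\<forall>c\<in>C. norm c = 1)"

lemma orthonormal_inner:
  assumes "orthonormal C" "a \<in> C" "b \<in> C"
  shows "a \<bullet> b = (if a = b then 1 else 0)"
  using assms by (auto simp: orthonormal_def pairwise_def orthogonal_def norm_eq_1)

lemma orthonormal_finite:
  fixes C :: "'a::euclidean_space set"
  shows "orthonormal C \<Longrightarrow> finite C"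
  by (simp add: orthonormal_def pairwise_orthogonal_imp_finite)

lemma orthonormal_independent:
  fixes C :: "'a::euclidean_space set"
  shows "orthonormal C \<Longrightarrow> independent C"
  by (intro pairwise_orthogonal_independent) (auto simp: orthonormal_def)

lemma orthonormal_inner_sum:
  fixes C :: "'a::euclidean_space set"
  assumes "orthonormal C" "c \<in> C"
  shows "(\<Sum>b\<in>C. f b *\<^sub>R b) \<bullet> c = f c"
proof -
  have "(\<Sum>b\<in>C. f b *\<^sub>R b) \<bullet> c = (\<Sum>b\<in>C. if b = c then f b else 0)"
    unfolding inner_sum_left using assms by (intro sum.cong) (auto simp: orthonormal_inner)
  then show ?thesis
    using orthonormal_finite[OF assms(1)] assms(2) by (simp add: sum.delta)
qed

lemma orthonormal_norm_sum:
  fixes C :: "'a::euclidean_space set"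
  assumes "orthonormal C"
  shows "(norm (\<Sum>b\<in>C. f b *\<^sub>R b))\<^sup>2 = (\<Sum>b\<in>C. (f b)\<^sup>2)"
  unfolding power2_norm_eq_inner using assms
  by (subst inner_sum_right) (simp add: orthonormal_inner_sum power2_eq_square)

text \<open>\<open>D\<close> is an orthonormal basis of the orthogonal complement of
  \<open>span C\<close> inside \<open>V\<close>, and the dimensions of the two parts add up.
  Orthogonality to the whole span is recorded because a later argument tests \<open>D\<close>
  against every vector in the range of a design.\<close>

lemma orthonormal_extend:
  fixes C :: "'a::euclidean_space set"
  assumes C: "orthonormal C" "C \<subseteq> V" and V: "subspace V"
  obtains D where "D \<subseteq> V" "orthonormal (C \<union> D)" "C \<inter> D = {}" "card C + card D = dim V"
    "\<And>x d. x \<in> span C \<Longrightarrow> d \<in> D \<Longrightarrow> x \<bullet> d = 0"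
proof -
  define W where "W = {y\<in>V. \<forall>x\<in>span C. orthogonal x y}"
  have "dim W + dim (span C) = dim V"
    unfolding W_def using C V by (intro dim_subspace_orthogonal_to_vectors) (auto intro: span_minimal[THEN subsetD])
  moreover have ind: "independent C"
    using C(1) by (rule orthonormal_independent)
  ultimately have dim: "card C + dim W = dim V"
    by (simp add: dim_eq_card_independent)
  have "subspace W"
    unfolding W_def using V by (auto simp: subspace_def orthogonal_clauses)
  then obtain D where D: "D \<subseteq> W" "pairwise orthogonal D" "\<And>x. x \<in> D \<Longrightarrow> norm x = 1" "card D = dim W"
    using orthonormal_basis_subspace by metis
  have CD: "x \<bullet> d = 0" if "x \<in> span C" "d \<in> D" for x d
    using that D(1) by (auto simp: W_def orthogonal_def)
  have DC: "d \<bullet> x = 0" if "x \<in> C" "d \<in> D" for x d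
    using CD[of x d] that by (simp add: span_base inner_commute)
  have "orthonormal (C \<union> D)"
    using C D CD DC unfolding orthonormal_def pairwise_def
    by (auto simp: orthogonal_def span_base)
  moreover have "C \<inter> D = {}"
  proof -
    have "x \<notin> D" if "x \<in> C" for x
      using CD[of x x] C that by (auto simp: span_base orthonormal_def norm_eq_1)
    then show ?thesis by auto
  qed
  ultimately show ?thesis
    using that[of D] dim D(1,4) CD by (auto simp: W_def)
qed

text \<open>The coordinates are independent and identically distributed, so a bijective renaming of
  the index set preserves every law. This carries results between \<open>Basis\<close>, orthonormal
  sets, initial segments of the naturals and index pairs.\<close>

lemma distr_PiM_std_normal_bij:
  assumes g: "bij_betw g I C" and H: "H \<in> (\<Pi>\<^sub>M i\<in>I. std_normal_distribution) \<rightarrow>\<^sub>M M"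
  shows "distr (\<Pi>\<^sub>M c\<in>C. std_normal_distribution) M (\<lambda>\<omega>. H (\<lambda>i\<in>I. \<omega> (g i)))
      = distr (\<Pi>\<^sub>M i\<in>I. std_normal_distribution) M H"
proof -
  let ?P = "\<lambda>I. \<Pi>\<^sub>M i\<in>I. std_normal_distribution"
  have "distr (?P I) M H = distr (distr (?P C) (?P I) (\<lambda>\<omega>. \<lambda>i\<in>I. \<omega> (g i))) M H"
    using g by (subst distr_PiM_reindex) (auto simp: bij_betw_def prob_space_std_normal)
  also have "\<dots> = distr (?P C) M (\<lambda>\<omega>. H (\<lambda>i\<in>I. \<omega> (g i)))"
  proof (subst distr_distr[OF H])
    show "(\<lambda>\<omega>. \<lambda>i\<in>I. \<omega> (g i)) \<in> ?P C \<rightarrow>\<^sub>M ?P I"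
      using bij_betw_apply[OF g] by (intro measurable_restrict measurable_component_singleton) auto
  qed (simp add: comp_def)
  finally show ?thesis ..
qed

text \<open>The linear map \<open>F\<close> sending \<open>Basis\<close> to \<open>C\<close> along a
  bijection preserves inner products, hence preserves \<open>std_gaussian\<close>; the image of the
  defining sum is the sum along \<open>C\<close>.\<close>

lemma std_gaussian_orthonormal_basis:
  fixes C :: "'a::euclidean_space set"
  assumes C: "orthonormal C" and card: "card C = DIM('a)"
  shows "distr (\<Pi>\<^sub>M c\<in>C. std_normal_distribution) borel (\<lambda>f. \<Sum>c\<in>C. f c *\<^sub>R c) = std_gaussian"
proof -
  let ?N = "std_normal_distribution"
  obtain g where g: "bij_betw g (Basis :: 'a set) C"
    using orthonormal_finite[OF C] card finite_same_card_bij[of Basis C] by auto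
  define F where "F = (\<lambda>x::'a. \<Sum>b\<in>Basis. (x \<bullet> b) *\<^sub>R g b)"
  have reix: "(\<Sum>b\<in>Basis. h (g b) *\<^sub>R g b) = (\<Sum>c\<in>C. h c *\<^sub>R c)" for h
    using sum.reindex_bij_betw[OF g, of "\<lambda>c. h c *\<^sub>R c"] .
  have lin: "linear F"
    unfolding F_def by (intro linear_compose_sum ballI linear_compose_scale_right)
      (auto intro!: linearI simp: inner_left_distrib scaleR_add_left)
  have gg: "g a \<bullet> g b = (if a = b then 1 else 0)" if "a \<in> Basis" "b \<in> Basis" for a b
    using that g bij_betw_apply[OF g] orthonormal_inner[OF C, of "g a" "g b"]
    by (auto dest: bij_betw_imp_inj_on inj_onD)
  have Fg: "F v \<bullet> g b = v \<bullet> b" if "b \<in> Basis" for v b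
    using that unfolding F_def inner_sum_left
    by (simp add: gg if_distrib[of "\<lambda>x. _ * x"] cong: if_cong)
  have "F v \<bullet> F w = v \<bullet> w" for v w
    by (subst (2) F_def) (simp add: inner_sum_right Fg euclidean_inner[of v w] mult.commute)
  with lin have F: "orthogonal_transformation F"
    by (simp add: orthogonal_transformation_def)
  have [measurable]: "F \<in> borel_measurable borel"
    unfolding F_def by measurable
  have "std_gaussian = distr (distr (\<Pi>\<^sub>M b\<in>Basis. ?N) borel (\<lambda>f. \<Sum>b\<in>Basis. f b *\<^sub>R b)) borel F"
    using std_gaussian_distr_orthogonal[OF F] by (simp add: std_gaussian_def)
  also have "\<dots> = distr (\<Pi>\<^sub>M b\<in>Basis. ?N) borel (\<lambda>f. \<Sum>b\<in>Basis. f b *\<^sub>R g b)"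
    by (subst distr_distr) (auto simp: comp_def F_def inner_sum_left_Basis cong: sum.cong)
  also have "\<dots> = distr (\<Pi>\<^sub>M c\<in>C. ?N) borel (\<lambda>\<omega>. \<Sum>b\<in>Basis. \<omega> (g b) *\<^sub>R g b)"
    by (subst distr_PiM_std_normal_bij[OF g, symmetric]) (auto cong: sum.cong)
  finally show ?thesis
    by (simp add: reix)
qed

text \<open>Two complementary groups of coordinates become the factors of a product measure, which
  is the form in which independence enters. It is applied to matrices, to separate
  \<open>S r\<close> from \<open>S X\<close>, and in \<open>real ^ 'k\<close>, to separate the range
  of the design from its complement.\<close>

lemma std_gaussian_split:
  fixes C D :: "'a::euclidean_space set"
  assumes CD: "orthonormal (C \<union> D)" "C \<inter> D = {}" "card C + card D = DIM('a)"
  shows "distr ((\<Pi>\<^sub>M c\<in>C. std_normal_distribution) \<Otimes>\<^sub>M (\<Pi>\<^sub>M d\<in>D. std_normal_distribution)) borel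
           (\<lambda>(f, g). (\<Sum>c\<in>C. f c *\<^sub>R c) + (\<Sum>d\<in>D. g d *\<^sub>R d)) = std_gaussian"
proof -
  let ?N = "std_normal_distribution"
  interpret product_prob_space "\<lambda>_::'a. ?N"
    by (rule product_prob_space_std_normal)
  have fin: "finite C" "finite D"
    using orthonormal_finite[OF CD(1)] by auto
  have "std_gaussian = distr (\<Pi>\<^sub>M c\<in>C \<union> D. ?N) borel (\<lambda>f. \<Sum>c\<in>C \<union> D. f c *\<^sub>R c)"
    using CD fin by (intro std_gaussian_orthonormal_basis[symmetric]) (auto simp: card_Un_disjoint)
  also have "(\<Pi>\<^sub>M c\<in>C \<union> D. ?N) = distr ((\<Pi>\<^sub>M c\<in>C. ?N) \<Otimes>\<^sub>M (\<Pi>\<^sub>M d\<in>D. ?N)) (\<Pi>\<^sub>M c\<in>C \<union> D. ?N) (merge C D)"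
    using CD fin by (intro distr_merge[symmetric])
  also have "distr \<dots> borel (\<lambda>f. \<Sum>c\<in>C \<union> D. f c *\<^sub>R c) = distr ((\<Pi>\<^sub>M c\<in>C. ?N) \<Otimes>\<^sub>M (\<Pi>\<^sub>M d\<in>D. ?N)) borel
      (\<lambda>p. \<Sum>c\<in>C \<union> D. merge C D p c *\<^sub>R c)"
    by (subst distr_distr) (auto simp: comp_def)
  also have "(\<lambda>p. \<Sum>c\<in>C \<union> D. merge C D p c *\<^sub>R c)
      = (\<lambda>(f, g). (\<Sum>c\<in>C. f c *\<^sub>R c) + (\<Sum>d\<in>D. g d *\<^sub>R d))"
  proof (rule ext, clarify)
    fix f g :: "'a \<Rightarrow> real"
    have "(\<Sum>c\<in>C. merge C D (f, g) c *\<^sub>R c) = (\<Sum>c\<in>C. f c *\<^sub>R c)"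
      using CD(2) by (intro sum.cong refl) simp
    moreover have "(\<Sum>c\<in>D. merge C D (f, g) c *\<^sub>R c) = (\<Sum>c\<in>D. g c *\<^sub>R c)"
      using CD(2) by (intro sum.cong refl) simp
    ultimately show "(\<Sum>c\<in>C \<union> D. merge C D (f, g) c *\<^sub>R c) = (\<Sum>c\<in>C. f c *\<^sub>R c) + (\<Sum>d\<in>D. g d *\<^sub>R d)"
      using fin CD(2) by (simp add: sum.union_disjoint)
  qed
  finally show ?thesis ..
qed

lemma distr_sum_squares_chi_square:
  assumes C: "finite C"
  shows "distr (\<Pi>\<^sub>M c\<in>C. std_normal_distribution) borel (\<lambda>f. \<Sum>c\<in>C. (f c)\<^sup>2) = chi_square_distribution (card C)"
proof -
  let ?N = "std_normal_distribution"
  obtain g where g: "bij_betw g {..<card C} C"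
    using C by (metis atLeast0LessThan ex_bij_betw_nat_finite)
  have "chi_square_distribution (card C) = distr (\<Pi>\<^sub>M c\<in>C. ?N) borel (\<lambda>\<omega>. \<Sum>i<card C. (\<omega> (g i))\<^sup>2)"
    unfolding chi_square_distribution_def
    by (subst distr_PiM_std_normal_bij[OF g, symmetric]) auto
  also have "(\<lambda>\<omega>. \<Sum>i<card C. (\<omega> (g i))\<^sup>2) = (\<lambda>\<omega>. \<Sum>c\<in>C. (\<omega> c)\<^sup>2)"
    using sum.reindex_bij_betw[OF g] by fastforce
  finally show ?thesis ..
qed

section \<open>Null sets and mixtures\<close>

lemma AE_std_normal_poly_nonzero:
  assumes "p \<noteq> 0"
  shows "AE t in std_normal_distribution. poly p t \<noteq> 0"
proof -
  have "{t. poly p t = 0} \<in> null_sets lborel"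
    using assms by (intro finite_imp_null_set_lborel poly_roots_finite)
  from AE_not_in[OF this] show ?thesis
    by (auto simp: AE_density)
qed

text \<open>Induction on the coordinates. With the new coordinate frozen at \<open>x0 i\<close>, the
  induction hypothesis gives a nonzero value for almost every choice of the others; then
  \<open>h\<close> is a nonzero polynomial in the new coordinate, with finitely many roots, and
  Fubini combines the two. \<open>x0\<close> is extensional so that restricting it to
  \<open>I\<close> and putting \<open>x0 i\<close> back returns \<open>x0\<close>; when there are no
  coordinates it is the only point.\<close>

lemma AE_PiM_std_normal_nonzero:
  fixes h :: "('i \<Rightarrow> real) \<Rightarrow> real"
  assumes "finite I" "h \<in> borel_measurable (\<Pi>\<^sub>M i\<in>I. std_normal_distribution)"
    and "\<And>x i. i \<in> I \<Longrightarrow> \<exists>p. \<forall>t. h (x(i := t)) = poly p t"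
    and "x0 \<in> extensional I" "h x0 \<noteq> 0"
  shows "AE x in (\<Pi>\<^sub>M i\<in>I. std_normal_distribution). h x \<noteq> 0"
  using assms
proof (induction I arbitrary: h x0)
  case empty
  then show ?case
    by (auto simp: space_PiM intro!: AE_I2)
next
  case (insert i I)
  let ?N = "std_normal_distribution"
  let ?P = "\<lambda>I. \<Pi>\<^sub>M i\<in>I. std_normal_distribution"
  interpret product_prob_space "\<lambda>_::'i. ?N"
    by (rule product_prob_space_std_normal)
  note [measurable] = insert.prems(1)
  have "AE x in ?P I. h (x(i := x0 i)) \<noteq> 0"
  proof (rule insert.IH[where ?x0.0 = "restrict x0 I"])
    show "(\<lambda>x. h (x(i := x0 i))) \<in> borel_measurable (?P I)"
      by (rule measurable_compose[OF measurable_fun_upd insert.prems(1)]) auto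
    show "\<exists>p. \<forall>t. h (x(j := t, i := x0 i)) = poly p t" if "j \<in> I" for x j
    proof -
      have "x(j := t, i := x0 i) = x(i := x0 i, j := t)" for t
        using insert.hyps that by auto
      then have "(\<lambda>t. h (x(j := t, i := x0 i))) = (\<lambda>t. h (x(i := x0 i, j := t)))"
        by metis
      moreover have "\<exists>p. \<forall>t. h (x(i := x0 i, j := t)) = poly p t"
        using insert.prems(2)[of j "x(i := x0 i)"] that by blast
      ultimately show ?thesis
        by (simp only: fun_eq_iff)
    qed
    have "(restrict x0 I)(i := x0 i) = x0"
      using insert.prems(3) by (auto simp: extensional_def)
    then show "h ((restrict x0 I)(i := x0 i)) \<noteq> 0"
      using insert.prems(4) by simp
    show "restrict x0 I \<in> extensional I"
      by simp
  qed
  then have AE: "AE x in ?P I. AE t in ?N. h (x(i := t)) \<noteq> 0"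
  proof (rule eventually_mono)
    fix x assume x: "h (x(i := x0 i)) \<noteq> 0"
    obtain p where p: "\<forall>t. h (x(i := t)) = poly p t"
      using insert.prems(2)[of i x] by blast
    then have "p \<noteq> 0" using x by (metis poly_0)
    from AE_std_normal_poly_nonzero[OF this] show "AE t in ?N. h (x(i := t)) \<noteq> 0"
      unfolding p[rule_format] .
  qed
  have "emeasure (?P (insert i I)) {x \<in> space (?P (insert i I)). h x = 0}
      = (\<integral>\<^sup>+x. indicator {x \<in> space (?P (insert i I)). h x = 0} x \<partial>?P (insert i I))"
    by (rule nn_integral_indicator[symmetric]) measurable
  also have "\<dots> = (\<integral>\<^sup>+x. indicator {0} (h x) \<partial>?P (insert i I))"
    by (intro nn_integral_cong) (auto simp: indicator_def)
  also have "\<dots> = (\<integral>\<^sup>+x. \<integral>\<^sup>+t. indicator {0} (h (x(i := t))) \<partial>?N \<partial>?P I)"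
    using insert.hyps by (intro product_nn_integral_insert) auto
  also have "\<dots> = (\<integral>\<^sup>+x. 0 \<partial>?P I)"
  proof (intro nn_integral_cong_AE, use AE in eventually_elim)
    case (elim x)
    then have "(\<integral>\<^sup>+t. indicator {0} (h (x(i := t))) \<partial>?N) = (\<integral>\<^sup>+t. 0 \<partial>?N)"
      by (intro nn_integral_cong_AE) (auto elim!: eventually_mono)
    then show ?case by simp
  qed
  finally show ?case
    by (subst AE_iff_measurable[OF _ refl]) auto
qed

text \<open>Conditioning: averaging a law that does not vary with the first argument changes
  nothing, since \<open>A\<close> has mass one. This is what allows the sketched design to be frozen
  while the laws are computed.\<close>

lemma distr_pair_const_law:
  assumes "prob_space A" "prob_space B"
    and h[measurable]: "h \<in> borel_measurable (A \<Otimes>\<^sub>M B)"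
    and D: "sets D = sets borel"
    and AE: "AE x in A. distr B borel (\<lambda>y. h (x, y)) = D"
  shows "distr (A \<Otimes>\<^sub>M B) borel h = D"
proof (rule measure_eqI)
  interpret A: prob_space A by fact
  interpret B: prob_space B by fact
  fix X assume "X \<in> sets (distr (A \<Otimes>\<^sub>M B) borel h)"
  then have X[measurable]: "X \<in> sets borel" by simp
  have "emeasure (distr (A \<Otimes>\<^sub>M B) borel h) X = (\<integral>\<^sup>+x. emeasure B (Pair x -` (h -` X \<inter> space (A \<Otimes>\<^sub>M B))) \<partial>A)"
    by (subst emeasure_distr) (measurable, rule B.emeasure_pair_measure_alt, measurable)
  also have "\<dots> = (\<integral>\<^sup>+x. emeasure D X \<partial>A)"
  proof (intro nn_integral_cong_AE, use AE AE_space in eventually_elim)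
    case (elim x)
    have "emeasure B (Pair x -` (h -` X \<inter> space (A \<Otimes>\<^sub>M B))) = emeasure (distr B borel (\<lambda>y. h (x, y))) X"
      using elim(2) by (subst emeasure_distr) (auto simp: space_pair_measure intro!: arg_cong[where f="emeasure B"])
    with elim show ?case by simp
  qed
  finally show "emeasure (distr (A \<Otimes>\<^sub>M B) borel h) X = emeasure D X"
    by (simp add: A.emeasure_space_1)
qed (use D in simp)

section \<open>Least squares\<close>

lemma matrix_inv_works:
  fixes A :: "real ^ 'n ^ 'n"
  assumes "invertible A"
  shows "A ** matrix_inv A = mat 1" "matrix_inv A ** A = mat 1"
  using assms someI_ex[of "\<lambda>B. A ** B = mat 1 \<and> B ** A = mat 1"]
  unfolding invertible_def matrix_inv_def by auto

lemma transpose_inner: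
  fixes A :: "real ^ 'p ^ 'k"
  shows "(transpose A *v w) \<bullet> u = w \<bullet> (A *v u)"
  by (simp add: dot_lmul_matrix)

lemma gram_inner:
  fixes A :: "real ^ 'p ^ 'k"
  shows "u \<bullet> ((transpose A ** A) *v v) = (A *v u) \<bullet> (A *v v)"
  using transpose_inner[of A "A *v v" u] by (simp only: matrix_vector_mul_assoc inner_commute)

text \<open>By \<open>gram_inner\<close> the quadratic form of the Gram matrix is the squared norm
  of \<open>A *v x\<close>, so a kernel vector of the Gram matrix is one of
  \<open>A\<close>.\<close>

lemma inj_gram_invertible:
  fixes A :: "real ^ 'p ^ 'k"
  assumes "inj ((*v) A)"
  shows "invertible (transpose A ** A)"
proof -
  have "inj ((*v) (transpose A ** A))"
  proof (rule injI)
    fix x y assume "(transpose A ** A) *v x = (transpose A ** A) *v y"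
    then have "(transpose A ** A) *v (x - y) = 0"
      by (simp add: matrix_vector_mult_diff_distrib)
    then have "(A *v (x - y)) \<bullet> (A *v (x - y)) = 0"
      using gram_inner[of "x - y" A "x - y"] by simp
    then show "x = y"
      using assms by (simp add: matrix_vector_mult_diff_distrib inj_on_def)
  qed
  then show ?thesis
    by (simp add: invertible_left_inverse matrix_left_invertible_injective)
qed

lemma gram_invertible_inj:
  fixes A :: "real ^ 'p ^ 'k"
  assumes "invertible (transpose A ** A)"
  shows "inj ((*v) A)"
proof (rule injI)
  fix x y assume "A *v x = A *v y"
  then have "(transpose A ** A) *v x = (transpose A ** A) *v y"
    by (simp only: matrix_vector_mul_assoc[symmetric])
  then show "x = y"
    using inj_matrix_vector_mult[OF assms] by (auto dest: injD)
qed

text \<open>Orthogonal decomposition into a vector in the range and a residual \<open>w\<close>,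
  from which the estimate and the residual sum can be read off. It serves both the full data, with
  \<open>w\<close> the residual of \<open>y\<close>, and the sketched data, with \<open>w\<close>
  the part of the noise orthogonal to the range.\<close>

lemma least_squares_decomp:
  fixes A :: "real ^ 'p ^ 'k"
  assumes inv: "invertible (transpose A ** A)" and w: "transpose A *v w = 0"
  shows "least_squares A (A *v u + w) = u"
    and "SSR A (A *v u + w) = (norm w)\<^sup>2"
proof -
  let ?G = "transpose A ** A"
  have "transpose A *v (A *v u + w) = ?G *v u"
    using w by (simp only: matrix_vector_right_distrib matrix_vector_mul_assoc) simp
  then have eq: "matrix_inv ?G *v (transpose A *v (A *v u + w)) = u"
    by (simp only: matrix_vector_mul_assoc matrix_inv_works[OF inv] matrix_vector_mul_lid)
  then show "least_squares A (A *v u + w) = u"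
    by (simp only: least_squares_def matrix_vector_mul_assoc[symmetric])
  have "(mat 1 - A ** matrix_inv ?G ** transpose A) *v (A *v u + w) = w"
    using eq by (simp only: matrix_vector_mult_diff_rdistrib matrix_vector_mul_assoc[symmetric] matrix_vector_mul_lid) simp
  moreover have "(A *v u) \<bullet> w = 0"
    using transpose_inner[of A w u] w by (simp add: inner_commute)
  ultimately show "SSR A (A *v u + w) = (norm w)\<^sup>2"
    by (simp add: SSR_def inner_left_distrib power2_norm_eq_inner)
qed

lemma least_squares_residual_orthogonal:
  fixes A :: "real ^ 'p ^ 'k"
  assumes inv: "invertible (transpose A ** A)"
  shows "transpose A *v (y - A *v least_squares A y) = 0"
proof -
  have "transpose A *v (A *v least_squares A y) = ((transpose A ** A) ** matrix_inv (transpose A ** A)) *v (transpose A *v y)"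
    by (simp only: least_squares_def matrix_vector_mul_assoc matrix_mul_assoc)
  then show ?thesis
    by (simp only: matrix_vector_mult_diff_distrib matrix_inv_works[OF inv] matrix_vector_mul_lid diff_self)
qed

text \<open>\<open>a\<close> represents the coordinate functional: it is the image under
  \<open>A\<close> of a vector that the Gram matrix sends to \<open>axis j 1\<close>. Taking that
  vector for \<open>d\<close> gives the squared norm of \<open>a\<close>. This ties the
  \<open>j\<close>-th entry of the estimate to a single direction in the range.\<close>

lemma gram_inverse_entry:
  fixes A :: "real ^ 'p ^ 'k" and j :: 'p
  assumes inv: "invertible (transpose A ** A)"
  defines "a \<equiv> A *v (matrix_inv (transpose A ** A) *v axis j 1)"
  shows "a \<bullet> (A *v d) = d $ j"
    and "matrix_inv (transpose A ** A) $ j $ j = (norm a)\<^sup>2"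
    and "norm a > 0"
proof -
  let ?G = "transpose A ** A"
  let ?u = "matrix_inv ?G *v axis j 1"
  have G: "?G *v ?u = axis j 1"
    by (simp only: matrix_vector_mul_assoc matrix_inv_works[OF inv] matrix_vector_mul_lid)
  show *: "a \<bullet> (A *v d) = d $ j" for d
    using gram_inner[of d A ?u] unfolding a_def G by (simp add: inner_axis inner_commute)
  have "?u $ j = matrix_inv ?G $ j $ j"
    by (simp add: matrix_vector_mul_component inner_axis)
  then show "matrix_inv ?G $ j $ j = (norm a)\<^sup>2"
    using *[of ?u] by (simp add: a_def power2_norm_eq_inner)
  have "a \<noteq> 0"
    using *[of "axis j 1"] by auto
  then show "norm a > 0" by simp
qed

section \<open>Measurability of matrix operations, the inverse and the least squares
  quantities\<close>

lemma borel_measurable_vec_iff: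
  fixes f :: "'w \<Rightarrow> ('a::euclidean_space) ^ 'n"
  shows "f \<in> borel_measurable M \<longleftrightarrow> (\<forall>i. (\<lambda>x. f x $ i) \<in> borel_measurable M)"
proof
  assume "\<forall>i. (\<lambda>x. f x $ i) \<in> borel_measurable M"
  then show "f \<in> borel_measurable M"
    unfolding borel_measurable_euclidean_space[of f]
    by (auto simp: Basis_vec_def inner_axis intro: borel_measurable_inner)
next
  assume [measurable]: "f \<in> borel_measurable M"
  have "(\<lambda>x. x $ i) \<in> borel_measurable borel" for i :: 'n
    by (intro borel_measurable_continuous_onI continuous_intros)
  from measurable_compose[OF \<open>f \<in> borel_measurable M\<close> this]
  show "\<forall>i. (\<lambda>x. f x $ i) \<in> borel_measurable M" by auto
qed

lemma borel_measurable_nth[measurable (raw)]: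
  fixes f :: "'w \<Rightarrow> ('a::euclidean_space) ^ 'n"
  shows "f \<in> borel_measurable M \<Longrightarrow> (\<lambda>x. f x $ i) \<in> borel_measurable M"
  by (simp add: borel_measurable_vec_iff)

lemma borel_measurable_matrix_ops[measurable (raw)]:
  fixes A :: "'w \<Rightarrow> real ^ 'm ^ 'n" and B :: "'w \<Rightarrow> real ^ 'l ^ 'm" and v :: "'w \<Rightarrow> real ^ 'm"
  assumes [measurable]: "A \<in> borel_measurable M"
  shows "(\<lambda>x. transpose (A x)) \<in> borel_measurable M"
    and "B \<in> borel_measurable M \<Longrightarrow> (\<lambda>x. A x ** B x) \<in> borel_measurable M"
    and "v \<in> borel_measurable M \<Longrightarrow> (\<lambda>x. A x *v v x) \<in> borel_measurable M"
  by (auto simp: borel_measurable_vec_iff transpose_def matrix_matrix_mult_def matrix_vector_mult_def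
      intro!: borel_measurable_sum borel_measurable_times borel_measurable_nth)

lemma borel_measurable_det[measurable (raw)]:
  fixes A :: "'w \<Rightarrow> real ^ 'n ^ 'n"
  assumes [measurable]: "A \<in> borel_measurable M"
  shows "(\<lambda>x. det (A x)) \<in> borel_measurable M"
  unfolding det_def by measurable

text \<open>Column \<open>l\<close> of the inverse solves a linear system with right-hand side
  \<open>axis l 1\<close>, to which Cramer's rule applies. The quotient of determinants replaces the
  choice in \<open>matrix_inv\<close> by an explicitly measurable expression.\<close>

lemma matrix_inv_cramer:
  fixes A :: "real ^ 'n ^ 'n"
  assumes "det A \<noteq> 0"
  shows "matrix_inv A $ i $ l = det (\<chi> a b. if b = i then axis l 1 $ a else A $ a $ b) / det A"
proof -
  have "invertible A"
    using assms by (simp add: invertible_det_nz)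
  then have "A *v (matrix_inv A *v axis l 1) = axis l 1"
    by (simp only: matrix_vector_mul_assoc matrix_inv_works matrix_vector_mul_lid)
  then have "matrix_inv A *v axis l 1 = (\<chi> i. det (\<chi> a b. if b = i then axis l 1 $ a else A $ a $ b) / det A)"
    using cramer[OF assms] by blast
  moreover have "(matrix_inv A *v axis l 1) $ i = matrix_inv A $ i $ l"
    by (simp add: matrix_vector_mul_component inner_axis)
  ultimately show ?thesis
    by (metis (lifting) vec_lambda_beta)
qed

lemma borel_measurable_matrix_inv[measurable (raw)]:
  fixes A :: "'w \<Rightarrow> real ^ 'n ^ 'n"
  assumes [measurable]: "A \<in> borel_measurable M"
  shows "(\<lambda>x. matrix_inv (A x)) \<in> borel_measurable M"
proof -
  \<comment> \<open>the common junk value of \<^const>\<open>matrix_inv\<close> at singular matrices\<close>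
  define Z :: "real ^ 'n ^ 'n" where "Z = (SOME B. False)"
  have Z: "matrix_inv B = Z" if "det B = 0" for B :: "real ^ 'n ^ 'n"
    using that invertible_det_nz[of B] unfolding invertible_def matrix_inv_def Z_def by meson
  have eq: "matrix_inv (A x) $ i $ l =
      (if det (A x) = 0 then Z $ i $ l
       else det (\<chi> a b. if b = i then axis l 1 $ a else A x $ a $ b) / det (A x))" for x i l
    by (simp add: Z matrix_inv_cramer)
  have B: "(\<lambda>x. \<chi> a b. if b = i then axis l 1 $ a else A x $ a $ b :: real ^ 'n ^ 'n) \<in> borel_measurable M" for i l
    by (simp add: borel_measurable_vec_iff) measurable
  note [measurable] = borel_measurable_det[OF B]
  have "(\<lambda>x. matrix_inv (A x) $ i $ l) \<in> borel_measurable M" for i l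
    unfolding eq by measurable
  then show ?thesis
    by (simp add: borel_measurable_vec_iff)
qed

lemma borel_measurable_least_squares[measurable (raw)]:
  fixes A :: "'w \<Rightarrow> real ^ 'p ^ 'k"
  assumes [measurable]: "A \<in> borel_measurable M" "v \<in> borel_measurable M"
  shows "(\<lambda>x. least_squares (A x) (v x)) \<in> borel_measurable M"
  unfolding least_squares_def by measurable

lemma borel_measurable_SSR[measurable (raw)]:
  fixes A :: "'w \<Rightarrow> real ^ 'p ^ 'k"
  assumes [measurable]: "A \<in> borel_measurable M" "v \<in> borel_measurable M"
  shows "(\<lambda>x. SSR (A x) (v x)) \<in> borel_measurable M"
  unfolding SSR_def by measurable

section \<open>Laws of the statistics for a fixed design\<close>

lemma powr_minus_half:
  fixes x :: real
  assumes "0 \<le> x"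
  shows "x powr (- 1 / 2) = 1 / sqrt x"
proof -
  have "x powr (- 1 / 2) = inverse (x powr (1 / 2))"
    by (simp only: powr_minus[symmetric] minus_divide_left)
  then show ?thesis
    using assms by (simp only: powr_half_sqrt inverse_eq_divide)
qed

text \<open>Functions of different factors are independent. This brings a statistic into the shape
  in which \<open>F_distribution\<close> and \<open>t_distribution\<close> are defined.\<close>

lemma distr_pair_product_map:
  assumes "prob_space A" "prob_space B"
    and [measurable]: "u \<in> borel_measurable A" "v \<in> borel_measurable B"
      "F \<in> borel_measurable (borel \<Otimes>\<^sub>M borel)"
  shows "distr (A \<Otimes>\<^sub>M B) borel (\<lambda>(x, y). F (u x, v y))
       = distr (distr A borel u \<Otimes>\<^sub>M distr B borel v) borel F"
proof -
  interpret V: prob_space "distr B borel v"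
    using assms by (intro prob_space.prob_space_distr) auto
  have "distr A borel u \<Otimes>\<^sub>M distr B borel v = distr (A \<Otimes>\<^sub>M B) (borel \<Otimes>\<^sub>M borel) (\<lambda>(x, y). (u x, v y))"
    by (intro pair_measure_distr V.sigma_finite_measure_axioms) measurable
  then show ?thesis
    by (simp add: distr_distr comp_def case_prod_unfold)
qed

lemma dim_range_gram_invertible:
  fixes A :: "real ^ 'p ^ 'k"
  assumes "invertible (transpose A ** A)"
  shows "dim (range ((*v) A)) = CARD('p)"
  using gram_invertible_inj[OF assms] full_rank_injective[of A] rank_dim_range[of A] by simp

text \<open>\<open>C\<close> is an orthonormal basis of the range of \<open>A\<close> and
  \<open>D\<close> one of its complement. Noise along \<open>C\<close> is absorbed by the estimate
  and noise along \<open>D\<close> is the residual, so the statistics split into separate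
  coordinates. The basis depends only on \<open>A\<close> and \<open>j\<close>, so it is fixed
  before the noise \<open>f\<close>, \<open>g\<close> is drawn.\<close>

lemma least_squares_orthonormal_coordinates:
  fixes A :: "real ^ 'p ^ 'k" and j :: 'p
  assumes inv: "invertible (transpose A ** A)"
  obtains C D :: "(real ^ 'k) set" and c where
    "orthonormal (C \<union> D)" "C \<inter> D = {}" "card C = CARD('p)" "card D = CARD('k) - CARD('p)"
    "card C + card D = DIM(real ^ 'k)" "c \<in> C" "matrix_inv (transpose A ** A) $ j $ j > 0"
    "\<And>b s f g y d. d = least_squares A y - b \<Longrightarrow>
       y = A *v b + s *\<^sub>R ((\<Sum>c\<in>C. f c *\<^sub>R c) + (\<Sum>c\<in>D. g c *\<^sub>R c)) \<Longrightarrow>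
       d \<bullet> ((transpose A ** A) *v d) = s\<^sup>2 * (\<Sum>c\<in>C. (f c)\<^sup>2) \<and>
       SSR A y = s\<^sup>2 * (\<Sum>c\<in>D. (g c)\<^sup>2) \<and>
       d $ j = s * sqrt (matrix_inv (transpose A ** A) $ j $ j) * f c"
proof -
  let ?V = "range ((*v) A)"
  define a where "a = A *v (matrix_inv (transpose A ** A) *v axis j 1)"
  note a = gram_inverse_entry[OF inv, of j, folded a_def]
  \<comment> \<open>\<open>d $ j\<close> is the inner product of \<open>A d\<close> with \<open>a\<close>, so the basis of the range of \<open>A\<close> is made to contain
    the direction of \<open>a\<close>.\<close>
  define c where "c = a /\<^sub>R norm a"
  have V: "subspace ?V"
    by (intro linear_subspace_image matrix_vector_mul_linear subspace_UNIV)
  have "a \<in> ?V" by (simp add: a_def)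
  then have c: "c \<in> ?V" "norm c = 1"
    using V a(3) by (auto simp: c_def intro: subspace_scale)
  have "orthonormal {c}" "{c} \<subseteq> ?V"
    using c by (auto simp: orthonormal_def)
  then obtain C' where C': "C' \<subseteq> ?V" "orthonormal ({c} \<union> C')" "{c} \<inter> C' = {}" "card {c} + card C' = dim ?V"
    using orthonormal_extend[OF _ _ V, of "{c}"] by metis
  define C where "C = {c} \<union> C'"
  have C: "orthonormal C" "C \<subseteq> ?V" "c \<in> C"
    using C' c by (auto simp: C_def)
  have fin: "finite C"
    by (rule orthonormal_finite[OF C(1)])
  have cardC: "card C = CARD('p)"
    using C' fin dim_range_gram_invertible[OF inv] by (auto simp: C_def card_Un_disjoint)
  have "independent C"
    using C(1) by (rule orthonormal_independent)
  then have span: "?V \<subseteq> span C"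
    using C(2) cardC dim_range_gram_invertible[OF inv] by (intro card_ge_dim_independent) auto
  obtain D where D: "orthonormal (C \<union> D)" "C \<inter> D = {}" "card C + card D = dim (UNIV :: (real ^ 'k) set)"
    "\<And>x d. x \<in> span C \<Longrightarrow> d \<in> D \<Longrightarrow> x \<bullet> d = 0"
    using orthonormal_extend[OF C(1) subset_UNIV subspace_UNIV] by metis
  have oD: "orthonormal D"
    using D(1) by (auto simp: orthonormal_def pairwise_def)
  have main: "d \<bullet> ((transpose A ** A) *v d) = s\<^sup>2 * (\<Sum>c\<in>C. (f c)\<^sup>2) \<and>
       SSR A y = s\<^sup>2 * (\<Sum>c\<in>D. (g c)\<^sup>2) \<and>
       d $ j = s * sqrt (matrix_inv (transpose A ** A) $ j $ j) * f c"
    if d: "d = least_squares A y - b"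
      and y: "y = A *v b + s *\<^sub>R ((\<Sum>c\<in>C. f c *\<^sub>R c) + (\<Sum>c\<in>D. g c *\<^sub>R c))" for b s f g y d
  proof -
    \<comment> \<open>The noise splits into \<open>s *\<^sub>R u\<close>, which lies in the range
      and so equals \<open>A *v e\<close>, and \<open>w\<close>, which is orthogonal to the range;
      the estimate therefore errs by exactly \<open>e\<close>.\<close>
    define u where "u = (\<Sum>c\<in>C. f c *\<^sub>R c)"
    define w where "w = s *\<^sub>R (\<Sum>c\<in>D. g c *\<^sub>R c)"
    have "s *\<^sub>R u \<in> ?V"
      unfolding u_def using C(2) V by (intro subspace_scale subspace_sum) (auto intro: subspace_scale)
    then obtain e where e: "s *\<^sub>R u = A *v e" by auto
    have yw: "y = A *v (b + e) + w"
      using y e by (simp add: u_def w_def scaleR_add_right matrix_vector_right_distrib)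
    have "(A *v v) \<bullet> w = 0" for v
    proof -
      have "(A *v v) \<bullet> x = 0" if "x \<in> D" for x
        using span D(4)[OF _ that, of "A *v v"] by auto
      then show ?thesis
        by (simp add: w_def inner_sum_right)
    qed
    then have "(transpose A *v w) \<bullet> v = 0" for v
      unfolding transpose_inner by (simp add: inner_commute)
    then have w: "transpose A *v w = 0"
      using inner_eq_zero_iff by blast
    note ls = least_squares_decomp[OF inv w, of "b + e", folded yw]
    have de: "d = e"
      using ls(1) d by simp
    have "d \<bullet> ((transpose A ** A) *v d) = (norm (s *\<^sub>R u))\<^sup>2"
      unfolding gram_inner de e power2_norm_eq_inner ..
    also have "\<dots> = s\<^sup>2 * (\<Sum>c\<in>C. (f c)\<^sup>2)"
      by (simp add: power_mult_distrib u_def orthonormal_norm_sum[OF C(1)])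
    finally have 1: "d \<bullet> ((transpose A ** A) *v d) = s\<^sup>2 * (\<Sum>c\<in>C. (f c)\<^sup>2)" .
    have 2: "SSR A y = s\<^sup>2 * (\<Sum>c\<in>D. (g c)\<^sup>2)"
      unfolding ls(2) w_def by (simp add: power_mult_distrib orthonormal_norm_sum[OF oD])
    \<comment> \<open>Pairing \<open>A *v d\<close> with \<open>a\<close> extracts the entry, and
      \<open>a\<close> points along the basis vector \<open>c\<close>, so only the coordinate
      \<open>f c\<close> survives.\<close>
    have "d $ j = (norm a *\<^sub>R c) \<bullet> (s *\<^sub>R u)"
      using a(1)[of d] a(3) by (simp add: de e[symmetric] c_def)
    also have "\<dots> = s * norm a * (u \<bullet> c)"
      by (simp add: inner_commute)
    also have "u \<bullet> c = f c"
      unfolding u_def by (rule orthonormal_inner_sum[OF C(1,3)])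
    finally have 3: "d $ j = s * sqrt (matrix_inv (transpose A ** A) $ j $ j) * f c"
      by (simp add: a(2))
    show ?thesis using 1 2 3 by blast
  qed
  show ?thesis
  proof (rule that[of C D c])
    show "card D = CARD('k) - CARD('p)"
      using D(3) cardC by simp
    show "matrix_inv (transpose A ** A) $ j $ j > 0"
      using a by simp
  qed (use D C cardC main in auto)
qed

text \<open>With the design fixed, the observation is \<open>A *v b\<close> plus noise of scale
  \<open>s\<close>. In the adapted basis the three statistics depend on the noise only through the
  sums of squares over \<open>C\<close> and \<open>D\<close> and the coordinate at \<open>c\<close>.
  The scale and the entry of the inverse Gram matrix cancel, so no trace of \<open>A\<close>,
  \<open>b\<close> or \<open>s\<close> is left in the laws.\<close>

lemma sketch_laws_given_design:
  fixes A :: "real ^ 'p ^ 'k" and b :: "real ^ 'p" and s :: real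
  assumes inv: "invertible (transpose A ** A)" and s: "s > 0"
  defines "G \<equiv> transpose A ** A" and "m \<equiv> CARD('k) - CARD('p)"
    and "y \<equiv> \<lambda>z. A *v b + s *\<^sub>R z"
  shows "distr std_gaussian borel
           (\<lambda>z. ((least_squares A (y z) - b) \<bullet> (G *v (least_squares A (y z) - b))) / s\<^sup>2)
         = chi_square_distribution CARD('p)" (is ?T1)
    and "distr std_gaussian borel
           (\<lambda>z. ((least_squares A (y z) - b) \<bullet> (G *v (least_squares A (y z) - b)) / real CARD('p))
              / (SSR A (y z) / real m))
         = F_distribution CARD('p) m" (is ?T2)
    and "distr std_gaussian borel
           (\<lambda>z. (least_squares A (y z) $ j - b $ j) * (SSR A (y z) / real m * matrix_inv G $ j $ j) powr (- 1 / 2))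
         = t_distribution m" (is ?T3)
proof -
  let ?N = "std_normal_distribution"
  have [measurable]: "y \<in> borel_measurable borel"
    unfolding y_def by measurable
  obtain C D :: "(real ^ 'k) set" and c where
    CD: "orthonormal (C \<union> D)" "C \<inter> D = {}" "card C + card D = DIM(real ^ 'k)"
    and card: "card C = CARD('p)" "card D = m" and c: "c \<in> C"
    and v: "matrix_inv G $ j $ j > 0"
    and coord: "\<And>b s f g y d. d = least_squares A y - b \<Longrightarrow>
       y = A *v b + s *\<^sub>R ((\<Sum>c\<in>C. f c *\<^sub>R c) + (\<Sum>c\<in>D. g c *\<^sub>R c)) \<Longrightarrow>
       d \<bullet> (G *v d) = s\<^sup>2 * (\<Sum>c\<in>C. (f c)\<^sup>2) \<and>
       SSR A y = s\<^sup>2 * (\<Sum>c\<in>D. (g c)\<^sup>2) \<and>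
       d $ j = s * sqrt (matrix_inv G $ j $ j) * f c"
    unfolding G_def m_def by (rule least_squares_orthonormal_coordinates[OF inv, of j]) blast
  define z :: "((real ^ 'k) \<Rightarrow> real) \<Rightarrow> ((real ^ 'k) \<Rightarrow> real) \<Rightarrow> real ^ 'k"
    where "z f g = (\<Sum>c\<in>C. f c *\<^sub>R c) + (\<Sum>c\<in>D. g c *\<^sub>R c)" for f g
  let ?C = "\<Pi>\<^sub>M c\<in>C. ?N" and ?D = "\<Pi>\<^sub>M c\<in>D. ?N"
  let ?U = "\<lambda>f. \<Sum>c\<in>C. (f c)\<^sup>2" and ?V = "\<lambda>g. \<Sum>c\<in>D. (g c)\<^sup>2"
  interpret PC: prob_space ?C by (rule prob_space_PiM_std_normal)
  interpret PD: prob_space ?D by (rule prob_space_PiM_std_normal)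
  have fin: "finite C" "finite D"
    using orthonormal_finite[OF CD(1)] by auto
  have U: "distr ?C borel ?U = chi_square_distribution CARD('p)"
    and V: "distr ?D borel ?V = chi_square_distribution m"
    using distr_sum_squares_chi_square[OF fin(1)] distr_sum_squares_chi_square[OF fin(2)] card by auto
  have cm: "(\<lambda>f. f c) \<in> borel_measurable ?C"
    using measurable_component_singleton[OF c, of "\<lambda>_. ?N"] by simp
  \<comment> \<open>\<open>distr_PiM_component\<close> has the factor measure itself as target; its
    measurable sets are the Borel sets.\<close>
  have "distr ?C borel (\<lambda>f. f c) = distr ?C ?N (\<lambda>f. f c)"
    by (rule distr_cong) simp_all
  also have "\<dots> = ?N"
    using c prob_space_std_normal by (rule distr_PiM_component[rotated])
  finally have N: "distr ?C borel (\<lambda>f. f c) = ?N" .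
  have split: "distr std_gaussian borel h = distr (?C \<Otimes>\<^sub>M ?D) borel (\<lambda>(f, g). h (z f g))"
    if [measurable]: "h \<in> borel_measurable borel" for h :: "real ^ 'k \<Rightarrow> real"
  proof -
    have zm: "(\<lambda>(f, g). z f g) \<in> borel_measurable (?C \<Otimes>\<^sub>M ?D)"
      unfolding z_def by measurable
    have "std_gaussian = distr (?C \<Otimes>\<^sub>M ?D) borel (\<lambda>(f, g). z f g)"
      using std_gaussian_split[OF CD] by (simp only: z_def)
    then have "distr std_gaussian borel h = distr (?C \<Otimes>\<^sub>M ?D) borel (h \<circ> (\<lambda>(f, g). z f g))"
      using distr_distr[OF that zm] by (rule ssubst)
    then show ?thesis
      by (simp only: comp_def case_prod_unfold)
  qed
  have lsU: "(least_squares A (y (z f g)) - b) \<bullet> (G *v (least_squares A (y (z f g)) - b)) = s\<^sup>2 * ?U f"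
    and SV: "SSR A (y (z f g)) = s\<^sup>2 * ?V g"
    and lsc: "least_squares A (y (z f g)) $ j - b $ j = s * sqrt (matrix_inv G $ j $ j) * f c" for f g
    using coord[OF refl, of "y (z f g)" b s f g] by (simp_all add: y_def z_def)
  show ?T1
  proof (subst split)
    have "distr (?C \<Otimes>\<^sub>M ?D) borel (\<lambda>(f, g). s\<^sup>2 * ?U f / s\<^sup>2) = distr (distr (?C \<Otimes>\<^sub>M ?D) ?C fst) borel ?U"
      using s by (subst distr_distr) (auto simp: comp_def case_prod_unfold)
    then show "distr (?C \<Otimes>\<^sub>M ?D) borel
        (\<lambda>(f, g). (least_squares A (y (z f g)) - b) \<bullet> (G *v (least_squares A (y (z f g)) - b)) / s\<^sup>2)
      = chi_square_distribution CARD('p)"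
      by (simp only: lsU PD.distr_pair_fst U)
  qed measurable
  show ?T2
  proof (subst split)
    let ?F = "\<lambda>(u :: real, v :: real). (u / real CARD('p)) / (v / real m)"
    have "s\<^sup>2 * ?U f / real CARD('p) / (s\<^sup>2 * ?V g / real m) = ?F (?U f, ?V g)" for f g
      using s by (simp add: field_simps)
    then have "distr (?C \<Otimes>\<^sub>M ?D) borel
        (\<lambda>(f, g). (least_squares A (y (z f g)) - b) \<bullet> (G *v (least_squares A (y (z f g)) - b)) / real CARD('p)
           / (SSR A (y (z f g)) / real m))
      = distr (?C \<Otimes>\<^sub>M ?D) borel (\<lambda>(f, g). ?F (?U f, ?V g))"
      by (simp only: lsU SV)
    also have "\<dots> = distr (distr ?C borel ?U \<Otimes>\<^sub>M distr ?D borel ?V) borel ?F"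
      by (rule distr_pair_product_map[OF PC.prob_space_axioms PD.prob_space_axioms]) measurable
    finally show "distr (?C \<Otimes>\<^sub>M ?D) borel
        (\<lambda>(f, g). (least_squares A (y (z f g)) - b) \<bullet> (G *v (least_squares A (y (z f g)) - b)) / real CARD('p)
           / (SSR A (y (z f g)) / real m))
      = F_distribution CARD('p) m"
      unfolding F_distribution_def U V .
  qed measurable
  show ?T3
  proof (subst split)
    let ?F = "\<lambda>(z :: real, v :: real). z / sqrt (v / real m)"
    have "(s * sqrt (matrix_inv G $ j $ j) * f c) * (s\<^sup>2 * ?V g / real m * matrix_inv G $ j $ j) powr (- 1 / 2)
        = ?F (f c, ?V g)" for f g
    proof -
      \<comment> \<open>Only nonnegativity is available at every point; at 0 both sides of
        \<open>powr_minus_half\<close> are 0 by convention. The factor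
        \<open>s * sqrt (matrix_inv G $ j $ j)\<close> then cancels, and with it the dependence on
        the design.\<close>
      have "0 \<le> s\<^sup>2 * ?V g / real m * matrix_inv G $ j $ j"
        using v by (intro mult_nonneg_nonneg divide_nonneg_nonneg sum_nonneg) auto
      then show ?thesis
        using s v by (simp only: powr_minus_half) (simp add: real_sqrt_mult real_sqrt_divide)
    qed
    then have "distr (?C \<Otimes>\<^sub>M ?D) borel
        (\<lambda>(f, g). (least_squares A (y (z f g)) $ j - b $ j) * (SSR A (y (z f g)) / real m * matrix_inv G $ j $ j) powr (- 1 / 2))
      = distr (?C \<Otimes>\<^sub>M ?D) borel (\<lambda>(f, g). ?F (f c, ?V g))"
      by (simp only: lsc SV)
    also have "\<dots> = distr (distr ?C borel (\<lambda>f. f c) \<Otimes>\<^sub>M distr ?D borel ?V) borel ?F"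
      by (rule distr_pair_product_map[OF PC.prob_space_axioms PD.prob_space_axioms cm]) measurable
    finally show "distr (?C \<Otimes>\<^sub>M ?D) borel
        (\<lambda>(f, g). (least_squares A (y (z f g)) $ j - b $ j) * (SSR A (y (z f g)) / real m * matrix_inv G $ j $ j) powr (- 1 / 2))
      = t_distribution m"
      unfolding t_distribution_def N V .
  qed measurable
qed

section \<open>The sketch\<close>

text \<open>By the Leibniz formula the determinant is a polynomial in the entries.\<close>

lemma det_poly_entries:
  fixes B :: "real \<Rightarrow> real ^ 'n ^ 'n"
  assumes "\<And>i j. \<exists>p. \<forall>t. B t $ i $ j = poly p t"
  shows "\<exists>p. \<forall>t. det (B t) = poly p t"
proof -
  obtain P where P: "\<And>i j t. B t $ i $ j = poly (P i j) t"
    using assms by metis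
  have "det (B t) = poly (\<Sum>\<pi>\<in>{\<pi>. \<pi> permutes UNIV}. [:of_int (sign \<pi>):] * (\<Prod>i\<in>UNIV. P i (\<pi> i))) t" for t
    unfolding det_def by (simp add: poly_sum poly_prod P)
  then show ?thesis by blast
qed

text \<open>The columns of \<open>E\<close> are distinct standard basis vectors, placed by the
  injection \<open>\<phi>\<close>. The matrix provides the point at which the Gram determinant is
  seen not to vanish.\<close>

lemma ex_gram_identity:
  assumes "CARD('p) \<le> CARD('k)"
  obtains E :: "real ^ 'p ^ 'k" where "transpose E ** E = mat 1"
proof -
  obtain \<phi> :: "'p \<Rightarrow> 'k" where \<phi>: "inj \<phi>"
    using assms card_le_inj[of "UNIV :: 'p set" "UNIV :: 'k set"] by auto
  define E :: "real ^ 'p ^ 'k" where "E = (\<chi> i l. if i = \<phi> l then 1 else 0)"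
  have "(transpose E ** E) $ a $ b = (mat 1 :: real ^ 'p ^ 'p) $ a $ b" for a b
  proof -
    have "(transpose E ** E) $ a $ b = (\<Sum>i\<in>UNIV. (if i = \<phi> a then 1 else 0) * (if i = \<phi> b then 1 else 0))"
      unfolding E_def transpose_def matrix_matrix_mult_def by simp
    also have "\<dots> = (\<Sum>i\<in>UNIV. if i = \<phi> a then (if \<phi> a = \<phi> b then 1 else 0) else 0)"
      by (rule sum.cong) auto
    also have "\<dots> = (mat 1 :: real ^ 'p ^ 'p) $ a $ b"
      using \<phi> by (auto simp: mat_def inj_def)
    finally show ?thesis .
  qed
  then show ?thesis
    using that[of E] by (simp add: vec_eq_iff)
qed

lemma matrix_add_rdistrib:
  fixes A B :: "real ^ 'n ^ 'k" and X :: "real ^ 'p ^ 'n"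
  shows "(A + B) ** X = A ** X + B ** X"
  by (simp add: vec_eq_iff matrix_matrix_mult_def distrib_right sum.distrib)

lemma sum_scaleR_matrix_mult:
  fixes X :: "real ^ 'p ^ 'n" and M :: "'i \<Rightarrow> real ^ 'n ^ 'k"
  shows "(\<Sum>i\<in>I. f i *\<^sub>R M i) ** X = (\<Sum>i\<in>I. f i *\<^sub>R (M i ** X))"
  by (induction I rule: infinite_finite_induct)
    (simp_all add: matrix_add_rdistrib scalar_matrix_assoc)

lemma sum_scaleR_matrix_vector_mult:
  fixes M :: "'i \<Rightarrow> real ^ 'n ^ 'k"
  shows "(\<Sum>i\<in>I. f i *\<^sub>R M i) *v x = (\<Sum>i\<in>I. f i *\<^sub>R (M i *v x))"
  by (induction I rule: infinite_finite_induct)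
    (simp_all add: matrix_vector_mult_add_rdistrib scaleR_matrix_vector_assoc)

text \<open>The Gram determinant of the sketched design is a polynomial in the Gaussian coordinates,
  so it suffices that it is nonzero at one point. Only the coordinates along \<open>D\<close> occur,
  because the matrices in \<open>C\<close> annihilate \<open>X\<close>.\<close>

lemma AE_sketched_design_full_rank:
  fixes X :: "real ^ 'p ^ 'n" and C D :: "(real ^ 'n ^ 'k) set"
  assumes inv: "invertible (transpose X ** X)" and le: "CARD('p) \<le> CARD('k)"
    and CD: "orthonormal (C \<union> D)" "C \<inter> D = {}" "card C + card D = DIM(real ^ 'n ^ 'k)"
    and C: "\<And>c. c \<in> C \<Longrightarrow> c ** X = 0"
  defines "A \<equiv> \<lambda>g. \<Sum>d\<in>D. g d *\<^sub>R (d ** X)"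
  shows "AE g in (\<Pi>\<^sub>M d\<in>D. std_normal_distribution). invertible (transpose (A g) ** A g)"
proof -
  have fin: "finite C" "finite D"
    using orthonormal_finite[OF CD(1)] by auto
  have [measurable]: "A \<in> borel_measurable (\<Pi>\<^sub>M d\<in>D. std_normal_distribution)"
    unfolding A_def by (rule measurable_sum_scaleR_PiM)
  obtain E :: "real ^ 'p ^ 'k" where E: "transpose E ** E = mat 1"
    using ex_gram_identity[OF le] .
  \<comment> \<open>\<open>E\<close> times a left inverse of \<open>X\<close>, chosen so that
    \<open>S ** X\<close> is \<open>E\<close>, whose Gram matrix is the identity. The coordinates of
    \<open>S\<close> along \<open>D\<close> are the required point.\<close>
  define S where "S = E ** (matrix_inv (transpose X ** X) ** transpose X)"
  have SX: "S ** X = E"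
    unfolding S_def matrix_mul_assoc[symmetric] by (simp only: matrix_inv_works[OF inv] matrix_mul_rid)
  have ind: "independent (C \<union> D)"
    using CD(1) by (rule orthonormal_independent)
  have "(UNIV :: (real ^ 'n ^ 'k) set) \<subseteq> span (C \<union> D)"
    using CD(2,3) fin ind by (intro card_ge_dim_independent) (auto simp: card_Un_disjoint)
  then have "(\<Sum>c\<in>C \<union> D. (S \<bullet> c) *\<^sub>R c) = S"
    using CD(1) fin by (intro orthonormal_basis_expand) (auto simp: orthonormal_def)
  then have "S ** X = (\<Sum>c\<in>C \<union> D. (S \<bullet> c) *\<^sub>R c) ** X"
    by (simp only:)
  also have "\<dots> = (\<Sum>c\<in>C \<union> D. (S \<bullet> c) *\<^sub>R (c ** X))"
    by (rule sum_scaleR_matrix_mult)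
  also have "\<dots> = (\<Sum>c\<in>D. (S \<bullet> c) *\<^sub>R (c ** X))"
    using fin C by (intro sum.mono_neutral_right) auto
  finally have A0: "A (restrict (\<lambda>d. S \<bullet> d) D) = E"
    by (simp add: A_def SX)
  have "AE g in (\<Pi>\<^sub>M d\<in>D. std_normal_distribution). det (transpose (A g) ** A g) \<noteq> 0"
  proof (rule AE_PiM_std_normal_nonzero[OF fin(2)])
    show "(\<lambda>g. det (transpose (A g) ** A g)) \<in> borel_measurable (\<Pi>\<^sub>M d\<in>D. std_normal_distribution)"
      by measurable
    show "restrict (\<lambda>d. S \<bullet> d) D \<in> extensional D"
      by simp
    show "det (transpose (A (restrict (\<lambda>d. S \<bullet> d) D)) ** A (restrict (\<lambda>d. S \<bullet> d) D)) \<noteq> 0"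
      unfolding A0 E by simp
    fix g d assume "d \<in> D"
    \<comment> \<open>Only the coordinate at \<open>d\<close> moves with \<open>t\<close>, so each
      entry of the design is affine in \<open>t\<close>.\<close>
    define P where "P i l = (\<Sum>c\<in>D. (if c = d then [:0, 1:] else [:g c:]) * [:(c ** X) $ i $ l:])" for i l
    have "A (g(d := t)) $ i $ l = poly (P i l) t" for t i l
      unfolding A_def P_def poly_sum sum_component vector_scaleR_component by (intro sum.cong) auto
    then have "(transpose (A (g(d := t))) ** A (g(d := t))) $ i $ j = poly (\<Sum>m\<in>UNIV. P m i * P m j) t" for t i j
      by (simp add: matrix_matrix_mult_def transpose_def poly_sum)
    then show "\<exists>p. \<forall>t. det (transpose (A (g(d := t))) ** A (g(d := t))) = poly p t"
      by (intro det_poly_entries) blast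
  qed
  then show ?thesis
    by (simp only: invertible_det_nz)
qed

text \<open>\<open>F\<close> sees the sketch only through \<open>Z ** X\<close> and
  \<open>Z *v r\<close>, which depend on disjoint groups of coordinates. Almost every design has
  full rank, so \<open>distr_pair_const_law\<close> reduces the claim to a fixed design and an
  independent Gaussian vector of scale \<open>norm r\<close>.\<close>

lemma distr_std_gaussian_sketch:
  fixes X :: "real ^ 'p ^ 'n" and r :: "real ^ 'n" and F :: "(real ^ 'p ^ 'k) \<times> (real ^ 'k) \<Rightarrow> real"
  assumes inv: "invertible (transpose X ** X)" and le: "CARD('p) \<le> CARD('k)"
    and r: "r \<noteq> 0" "transpose X *v r = 0"
    and F: "F \<in> borel_measurable (borel \<Otimes>\<^sub>M borel)"
    and L: "sets L = sets borel"
    and law: "\<And>A. invertible (transpose A ** A) \<Longrightarrow> distr std_gaussian borel (\<lambda>z. F (A, norm r *\<^sub>R z)) = L"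
  shows "distr std_gaussian borel (\<lambda>Z. F (Z ** X, Z *v r)) = L"
proof -
  let ?N = "std_normal_distribution"
  \<comment> \<open>The rank-one matrix whose rows are multiples of \<open>r\<close>. Inner products
    with it read off the components of \<open>Z *v r\<close>, the map preserves inner products, and
    its values annihilate \<open>X\<close> because \<open>r\<close> is orthogonal to the columns of
    \<open>X\<close>.\<close>
  define lift :: "real ^ 'k \<Rightarrow> real ^ 'n ^ 'k" where "lift b = (\<chi> i. (b $ i / norm r) *\<^sub>R r)" for b
  have lift_inner: "Z \<bullet> lift b = (Z *v r) \<bullet> b / norm r" for Z b
    by (simp add: lift_def inner_vec_def[of Z] inner_vec_def[of "Z *v r"] matrix_vector_mul_component
        sum_divide_distrib mult.commute)
  have lift_r: "lift b *v r = norm r *\<^sub>R b" for b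
    using r(1) by (simp add: vec_eq_iff matrix_vector_mul_component lift_def
        dot_square_norm power2_eq_square)
  have lift_X: "lift b ** X = 0" for b
  proof -
    have "(\<Sum>m\<in>UNIV. r $ m * X $ m $ l) = 0" for l
      using r(2) by (simp add: vec_eq_iff vector_matrix_mult_def mult.commute)
    then show ?thesis
      by (simp add: vec_eq_iff matrix_matrix_mult_def lift_def mult.assoc sum_distrib_left[symmetric]
          sum_divide_distrib[symmetric])
  qed
  have ll: "lift a \<bullet> lift b = a \<bullet> b" for a b
    using r(1) by (simp add: lift_inner lift_r)
  define C where "C = lift ` Basis"
  have inj: "inj_on lift Basis"
    using r(1) by (auto intro!: inj_onI dest: arg_cong[of _ _ "\<lambda>Z. Z *v r"] simp: lift_r)
  then have bij: "bij_betw lift Basis C"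
    by (simp add: C_def bij_betw_def)
  have C_X: "c ** X = 0" if "c \<in> C" for c
    using that by (auto simp: C_def lift_X)
  have "orthonormal C"
    unfolding orthonormal_def pairwise_def C_def
    by (auto simp: orthogonal_def ll norm_eq_sqrt_inner inner_Basis)
  then obtain D where D: "orthonormal (C \<union> D)" "C \<inter> D = {}" "card C + card D = dim (UNIV :: (real ^ 'n ^ 'k) set)"
    "\<And>x d. x \<in> span C \<Longrightarrow> d \<in> D \<Longrightarrow> x \<bullet> d = 0"
    using orthonormal_extend[of C UNIV] by (metis subset_UNIV subspace_UNIV)
  \<comment> \<open>Orthogonality to every \<open>lift b\<close> says exactly that all components of
    \<open>d *v r\<close> vanish.\<close>
  have D_r: "d *v r = 0" if "d \<in> D" for d
  proof -
    have "(d *v r) \<bullet> b = 0" if "b \<in> Basis" for b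
    proof -
      have "lift b \<bullet> d = 0"
        using that \<open>d \<in> D\<close> by (intro D(4)) (auto simp: C_def span_base)
      then show ?thesis
        using r(1) by (simp add: inner_commute[of "lift b"] lift_inner)
    qed
    then show ?thesis
      by (simp add: euclidean_eq_iff[of "d *v r"])
  qed
  let ?C = "\<Pi>\<^sub>M c\<in>C. ?N" and ?D = "\<Pi>\<^sub>M d\<in>D. ?N"
  define A where "A g = (\<Sum>d\<in>D. g d *\<^sub>R (d ** X))" for g
  \<comment> \<open>The coordinates along \<open>C\<close>, reassembled as a vector of
    \<open>real ^ 'k\<close>; its law is standard Gaussian because \<open>lift\<close> maps
    \<open>Basis\<close> bijectively onto \<open>C\<close>.\<close>
  define e where "e f = (\<Sum>b\<in>Basis. f (lift b) *\<^sub>R b)" for f :: "real ^ 'n ^ 'k \<Rightarrow> real"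
  have A_meas: "A \<in> borel_measurable ?D"
    unfolding A_def by (rule measurable_sum_scaleR_PiM)
  have e_law: "distr ?C borel e = std_gaussian"
    unfolding std_gaussian_def e_def
    by (subst distr_PiM_std_normal_bij[OF bij, symmetric]) (auto cong: sum.cong)
  have e_meas: "e \<in> borel_measurable ?C"
    unfolding e_def using bij_betw_apply[OF bij]
    by (intro borel_measurable_sum borel_measurable_scaleR borel_measurable_const
        measurable_component_singleton[of _ _ "\<lambda>_. ?N", simplified]) auto
  define Z where "Z g f = (\<Sum>d\<in>D. g d *\<^sub>R d) + (\<Sum>c\<in>C. f c *\<^sub>R c)" for g f :: "real ^ 'n ^ 'k \<Rightarrow> real"
  have ZX: "Z g f ** X = A g" for g f
    unfolding Z_def A_def matrix_add_rdistrib sum_scaleR_matrix_mult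
    using C_X by simp
  have Zr: "Z g f *v r = norm r *\<^sub>R e f" for g f
  proof -
    have "Z g f *v r = (\<Sum>c\<in>C. f c *\<^sub>R (c *v r))"
      unfolding Z_def matrix_vector_mult_add_rdistrib sum_scaleR_matrix_vector_mult
      by (simp add: D_r)
    also have "\<dots> = norm r *\<^sub>R e f"
      using sum.reindex_bij_betw[OF bij, of "\<lambda>c. f c *\<^sub>R (c *v r)"]
      by (simp add: lift_r e_def scaleR_sum_right mult.commute)
    finally show ?thesis .
  qed
  have FZ: "(\<lambda>Z. F (Z ** X, Z *v r)) \<in> borel_measurable borel"
    by (rule measurable_compose[OF _ F]) measurable
  have Zm: "(\<lambda>(g, f). Z g f) \<in> borel_measurable (?D \<Otimes>\<^sub>M ?C)"
    unfolding Z_def by measurable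
  \<comment> \<open>The design coordinates come first, since \<open>distr_pair_const_law\<close>
    freezes the first argument.\<close>
  have "std_gaussian = distr (?D \<Otimes>\<^sub>M ?C) borel (\<lambda>(g, f). Z g f)"
    unfolding Z_def using D(1,2,3) by (intro std_gaussian_split[symmetric]) (auto simp: Un_commute)
  then have "distr std_gaussian borel (\<lambda>Z. F (Z ** X, Z *v r))
      = distr (?D \<Otimes>\<^sub>M ?C) borel ((\<lambda>Z. F (Z ** X, Z *v r)) \<circ> (\<lambda>(g, f). Z g f))"
    using distr_distr[OF FZ Zm] by (rule ssubst)
  also have "(\<lambda>Z. F (Z ** X, Z *v r)) \<circ> (\<lambda>(g, f). Z g f) = (\<lambda>p. F (A (fst p), norm r *\<^sub>R e (snd p)))"
    by (auto simp: ZX Zr)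
  also have "distr (?D \<Otimes>\<^sub>M ?C) borel \<dots> = L"
  proof (rule distr_pair_const_law[OF prob_space_PiM_std_normal prob_space_PiM_std_normal _ L])
    have "(\<lambda>p. (A (fst p), norm r *\<^sub>R e (snd p))) \<in> (?D \<Otimes>\<^sub>M ?C) \<rightarrow>\<^sub>M borel \<Otimes>\<^sub>M borel"
      by (intro measurable_Pair measurable_compose[OF measurable_fst A_meas] borel_measurable_scaleR
          borel_measurable_const measurable_compose[OF measurable_snd e_meas])
    from measurable_compose[OF this F]
    show "(\<lambda>p. F (A (fst p), norm r *\<^sub>R e (snd p))) \<in> borel_measurable (?D \<Otimes>\<^sub>M ?C)" .
    have "AE g in ?D. invertible (transpose (A g) ** A g)"
      unfolding A_def using D(3)
      by (intro AE_sketched_design_full_rank[OF inv le D(1,2)]) (simp_all add: C_X)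
    then show "AE g in ?D. distr ?C borel (\<lambda>f. F (A (fst (g, f)), norm r *\<^sub>R e (snd (g, f)))) = L"
    proof (rule eventually_mono)
      fix g assume g: "invertible (transpose (A g) ** A g)"
      have Fz: "(\<lambda>z. F (A g, norm r *\<^sub>R z)) \<in> borel_measurable borel"
        by (rule measurable_compose[OF _ F]) measurable
      have "distr ?C borel ((\<lambda>z. F (A g, norm r *\<^sub>R z)) \<circ> e) = L"
        unfolding distr_distr[OF Fz e_meas, symmetric] e_law by (rule law[OF g])
      then show "distr ?C borel (\<lambda>f. F (A (fst (g, f)), norm r *\<^sub>R e (snd (g, f)))) = L"
        by (simp only: comp_def fst_conv snd_conv)
    qed
  qed
  finally show ?thesis .
qed

section \<open>From the sketching matrix to the standard Gaussian on matrices, and the three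
  laws\<close>

lemma gaussian_sketch_law:
  fixes S :: "'w \<Rightarrow> real ^ 'n ^ 'k"
  assumes "gaussian_sketch M S"
  shows "S \<in> borel_measurable M"
    and "distr M borel (\<lambda>\<omega>. sqrt (real CARD('k)) *\<^sub>R S \<omega>) = std_gaussian"
proof -
  let ?N = "std_normal_distribution" and ?s = "sqrt (real CARD('k))"
  interpret prob_space M
    using assms by (simp add: gaussian_sketch_def)
  have ind: "indep_vars (\<lambda>_. borel) (\<lambda>(i, j) \<omega>. S \<omega> $ i $ j) (UNIV :: ('k \<times> 'n) set)"
    and dist: "\<And>i j. distributed M lborel (\<lambda>\<omega>. S \<omega> $ i $ j) (normal_density 0 (sqrt (1 / real CARD('k))))"
    using assms by (auto simp: gaussian_sketch_def)
  have entry: "(\<lambda>\<omega>. S \<omega> $ i $ j) \<in> borel_measurable M" for i j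
    using distributed_measurable[OF dist[of i j]] by simp
  then show S: "S \<in> borel_measurable M"
    by (simp add: borel_measurable_vec_iff)
  \<comment> \<open>The factor turns the variance \<open>1/k\<close> into 1. The scaled entries stay
    independent, so their joint law is a product of standard normals.\<close>
  define W where "W = (\<lambda>(i, j) \<omega>. ?s * S \<omega> $ i $ j)"
  have W: "indep_vars (\<lambda>_. borel) W UNIV"
    using indep_vars_compose2[OF ind, of "\<lambda>_ x. ?s * x" "\<lambda>_. borel"]
    by (simp add: W_def case_prod_unfold)
  have Wm: "random_variable borel (W ij)" for ij
    using entry by (auto simp: W_def case_prod_unfold)
  have "distr M borel (W ij) = ?N" for ij
  proof -
    have "distributed M lborel (\<lambda>\<omega>. 0 + ?s * S \<omega> $ fst ij $ snd ij) (normal_density (0 + ?s * 0) (\<bar>?s\<bar> * sqrt (1 / real CARD('k))))"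
      using dist by (intro normal_density_affine) auto
    then have "distributed M lborel (W ij) std_normal_density"
      by (simp add: W_def case_prod_unfold real_sqrt_divide)
    then have "distr M lborel (W ij) = ?N"
      by (simp add: distributed_distr_eq_density)
    then show ?thesis
      by (metis distr_cong sets_lborel)
  qed
  then have joint: "distr M (\<Pi>\<^sub>M ij\<in>UNIV. borel) (\<lambda>\<omega>. \<lambda>ij\<in>UNIV. W ij \<omega>) = (\<Pi>\<^sub>M ij\<in>UNIV. ?N)"
    using W Wm by (subst (asm) indep_vars_iff_distr_eq_PiM) auto
  \<comment> \<open>The matrix units, which form the standard basis of the matrix space, indexed by
    entry positions.\<close>
  define h :: "'k \<times> 'n \<Rightarrow> real ^ 'n ^ 'k" where "h = (\<lambda>(i, j). axis i (axis j 1))"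
  have h: "bij_betw h UNIV Basis"
    unfolding bij_betw_def
  proof
    show "inj h"
      by (auto simp: h_def inj_def axis_eq_axis)
    show "range h = Basis"
      by (auto simp: h_def Basis_vec_def image_def)
  qed
  have "distr M borel (\<lambda>\<omega>. ?s *\<^sub>R S \<omega>)
      = distr (distr M (\<Pi>\<^sub>M ij\<in>UNIV. borel) (\<lambda>\<omega>. \<lambda>ij\<in>UNIV. W ij \<omega>)) borel (\<lambda>w. \<Sum>ij\<in>UNIV. w ij *\<^sub>R h ij)"
  proof (subst distr_distr)
    have "?s *\<^sub>R S \<omega> = (\<Sum>ij\<in>UNIV. W ij \<omega> *\<^sub>R h ij)" for \<omega>
    proof -
      have "?s *\<^sub>R S \<omega> = (\<Sum>b\<in>Basis. ((?s *\<^sub>R S \<omega>) \<bullet> b) *\<^sub>R b)"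
        by (rule euclidean_representation[symmetric])
      also have "\<dots> = (\<Sum>ij\<in>UNIV. ((?s *\<^sub>R S \<omega>) \<bullet> h ij) *\<^sub>R h ij)"
        by (rule sum.reindex_bij_betw[OF h, symmetric])
      also have "\<dots> = (\<Sum>ij\<in>UNIV. W ij \<omega> *\<^sub>R h ij)"
        by (intro sum.cong) (auto simp: h_def W_def inner_axis)
      finally show ?thesis .
    qed
    then show "distr M borel (\<lambda>\<omega>. ?s *\<^sub>R S \<omega>) = distr M borel ((\<lambda>w. \<Sum>ij\<in>UNIV. w ij *\<^sub>R h ij) \<circ> (\<lambda>\<omega>. \<lambda>ij\<in>UNIV. W ij \<omega>))"
      by (simp add: comp_def)
    show "(\<lambda>\<omega>. \<lambda>ij\<in>UNIV. W ij \<omega>) \<in> M \<rightarrow>\<^sub>M (\<Pi>\<^sub>M ij\<in>UNIV. borel)"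
      using Wm by (intro measurable_restrict)
  qed measurable
  also have "\<dots> = distr (\<Pi>\<^sub>M ij\<in>UNIV. ?N) borel (\<lambda>w. \<Sum>ij\<in>UNIV. w ij *\<^sub>R h ij)"
    by (simp only: joint)
  also have "\<dots> = distr (\<Pi>\<^sub>M b\<in>Basis. ?N) borel (\<lambda>w. \<Sum>ij\<in>UNIV. w (h ij) *\<^sub>R h ij)"
    by (subst distr_PiM_std_normal_bij[OF h, symmetric]) auto
  also have "\<dots> = std_gaussian"
    unfolding std_gaussian_def using sum.reindex_bij_betw[OF h, of "\<lambda>b. w b *\<^sub>R b" for w] by simp
  finally show "distr M borel (\<lambda>\<omega>. ?s *\<^sub>R S \<omega>) = std_gaussian" .
qed

text \<open>\<open>S\<close> has the law of a standard Gaussian matrix divided by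
  \<open>sqrt k\<close>, and \<open>F'\<close> moves that factor into the arguments. Because
  \<open>law\<close> is assumed for every design of full rank, it applies to the rescaled design,
  and only the scale of the residual noise changes.\<close>

lemma has_law_sketch:
  fixes X :: "real ^ 'p ^ 'n" and r :: "real ^ 'n" and S :: "'w \<Rightarrow> real ^ 'n ^ 'k"
    and F :: "(real ^ 'p ^ 'k) \<times> (real ^ 'k) \<Rightarrow> real"
  assumes S: "gaussian_sketch M S"
    and X: "invertible (transpose X ** X)" "CARD('p) \<le> CARD('k)"
    and r: "r \<noteq> 0" "transpose X *v r = 0"
    and F: "F \<in> borel_measurable (borel \<Otimes>\<^sub>M borel)"
    and L: "sets L = sets borel"
    and law: "\<And>A. invertible (transpose A ** A) \<Longrightarrow>
      distr std_gaussian borel (\<lambda>z. F (A, (norm r / sqrt (real CARD('k))) *\<^sub>R z)) = L"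
  shows "has_law M (\<lambda>\<omega>. F (S \<omega> ** X, S \<omega> *v r)) L"
proof -
  define c where "c = sqrt (real CARD('k))"
  have c: "c > 0" by (simp add: c_def)
  note Sm = gaussian_sketch_law(1)[OF S]
  define F' where "F' = (\<lambda>p. F ((1 / c) *\<^sub>R fst p, (1 / c) *\<^sub>R snd p))"
  have F': "F' \<in> borel_measurable (borel \<Otimes>\<^sub>M borel)"
    unfolding F'_def by (rule measurable_compose[OF _ F]) measurable
  have Z: "distr std_gaussian borel (\<lambda>Z. F' (Z ** X, Z *v r)) = L"
  proof (rule distr_std_gaussian_sketch[OF X r F' L])
    fix A :: "real ^ 'p ^ 'k" assume "invertible (transpose A ** A)"
    then have "invertible ((1 / c)\<^sup>2 *\<^sub>R (transpose A ** A))"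
      using c by (intro scalar_invertible) auto
    then have "invertible (transpose ((1 / c) *\<^sub>R A) ** ((1 / c) *\<^sub>R A))"
      by (simp add: transpose_scalar matrix_scalar_ac scalar_matrix_assoc[symmetric] power2_eq_square)
    from law[OF this] show "distr std_gaussian borel (\<lambda>z. F' (A, norm r *\<^sub>R z)) = L"
      by (simp add: F'_def c_def)
  qed
  have Fm: "(\<lambda>Z. F' (Z ** X, Z *v r)) \<in> borel_measurable borel"
    by (rule measurable_compose[OF _ F']) measurable
  have FS: "(\<lambda>\<omega>. F (S \<omega> ** X, S \<omega> *v r)) \<in> borel_measurable M"
    by (rule measurable_compose[OF _ F]) (use Sm in measurable)
  have cS: "(\<lambda>\<omega>. c *\<^sub>R S \<omega>) \<in> borel_measurable M"
    using Sm by measurable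
  have "F' ((c *\<^sub>R S \<omega>) ** X, (c *\<^sub>R S \<omega>) *v r) = F (S \<omega> ** X, S \<omega> *v r)" for \<omega>
    using c by (simp add: F'_def scalar_matrix_assoc[symmetric] scaleR_matrix_vector_assoc[symmetric])
  then have "distr M borel (\<lambda>\<omega>. F (S \<omega> ** X, S \<omega> *v r))
      = distr M borel ((\<lambda>Z. F' (Z ** X, Z *v r)) \<circ> (\<lambda>\<omega>. c *\<^sub>R S \<omega>))"
    by (simp add: comp_def)
  also have "\<dots> = distr std_gaussian borel (\<lambda>Z. F' (Z ** X, Z *v r))"
    by (simp only: distr_distr[OF Fm cS, symmetric] gaussian_sketch_law(2)[OF S, folded c_def])
  finally show ?thesis
    using FS Z by (simp add: has_law_def)
qed

theorem mainTheorem2: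
  fixes X :: "real ^ 'p ^ 'n" and y :: "real ^ 'n"
    and M :: "'w measure" and S :: "'w \<Rightarrow> real ^ 'n ^ 'k"
    and Xs :: "'w \<Rightarrow> real ^ 'p ^ 'k" and ys :: "'w \<Rightarrow> real ^ 'k"
    and \<beta>F :: "real ^ 'p" and \<beta>s :: "'w \<Rightarrow> real ^ 'p"
    and SSRF :: real and SSRs :: "'w \<Rightarrow> real"
    and n p k :: nat
  defines "n \<equiv> CARD('n)" and "p \<equiv> CARD('p)" and "k \<equiv> CARD('k)"
    and "Xs \<equiv> \<lambda>\<omega>. S \<omega> ** X" and "ys \<equiv> \<lambda>\<omega>. S \<omega> *v y"
    and "\<beta>F \<equiv> least_squares X y" and "\<beta>s \<equiv> \<lambda>\<omega>. least_squares (Xs \<omega>) (ys \<omega>)"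
    and "SSRF \<equiv> SSR X y" and "SSRs \<equiv> \<lambda>\<omega>. SSR (Xs \<omega>) (ys \<omega>)"
  assumes "rank X = p" and "p < n"
    and "SSRF > 0"
    and "k > p"
    and "gaussian_sketch M S"
  shows "has_law M
           (\<lambda>\<omega>. ((\<beta>s \<omega> - \<beta>F) \<bullet> ((transpose (Xs \<omega>) ** Xs \<omega>) *v (\<beta>s \<omega> - \<beta>F))) / (SSRF / real k))
           (chi_square_distribution p)
         \<and> has_law M
           (\<lambda>\<omega>. ((\<beta>s \<omega> - \<beta>F) \<bullet> ((transpose (Xs \<omega>) ** Xs \<omega>) *v (\<beta>s \<omega> - \<beta>F)) / real p)
                 / (SSRs \<omega> / real (k - p)))
           (F_distribution p (k - p))
         \<and> (\<forall>j. has_law M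
           (\<lambda>\<omega>. (\<beta>s \<omega> $ j - \<beta>F $ j) *
                 (SSRs \<omega> / real (k - p) * matrix_inv (transpose (Xs \<omega>) ** Xs \<omega>) $ j $ j) powr (- 1 / 2))
           (t_distribution (k - p)))"
proof -
  have inv: "invertible (transpose X ** X)"
    using \<open>rank X = p\<close> full_rank_injective[of X] by (intro inj_gram_invertible) (simp add: p_def)
  have le: "CARD('p) \<le> CARD('k)"
    using \<open>k > p\<close> by (simp add: p_def k_def)
  define r where "r = y - X *v \<beta>F"
  have Xr: "transpose X *v r = 0"
    unfolding r_def \<beta>F_def by (rule least_squares_residual_orthogonal[OF inv])
  have y: "y = X *v \<beta>F + r"
    by (simp add: r_def)
  have SSRF: "SSRF = (norm r)\<^sup>2"
    unfolding SSRF_def y by (rule least_squares_decomp(2)[OF inv Xr])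
  with \<open>SSRF > 0\<close> have r: "r \<noteq> 0" by auto
  \<comment> \<open>The standard deviation of each component of \<open>S \<omega> *v r\<close>; its
    square is the denominator in (i).\<close>
  define s where "s = norm r / sqrt (real k)"
  have s: "s > 0" and s2: "SSRF / real k = s\<^sup>2"
    using r by (auto simp: s_def SSRF power_divide k_def)
  \<comment> \<open>Sketching turns the decomposition of \<open>y\<close> into a linear model with
    true coefficient \<open>\<beta>F\<close> and Gaussian noise
    \<open>S \<omega> *v r\<close>.\<close>
  have ys: "ys = (\<lambda>\<omega>. Xs \<omega> *v \<beta>F + S \<omega> *v r)"
    unfolding ys_def Xs_def by (subst y) (simp only: matrix_vector_right_distrib matrix_vector_mul_assoc)
  note sketch = has_law_sketch[OF \<open>gaussian_sketch M S\<close> inv le r Xr]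
  note laws = sketch_laws_given_design[OF _ s, where b = \<beta>F]
  \<comment> \<open>The statistics as functions of the pair of sketched design and sketched
    residual, the form that \<open>has_law_sketch\<close> expects.\<close>
  define F1 F2 F3 where
    "F1 = (\<lambda>(A :: real ^ 'p ^ 'k, e). ((least_squares A (A *v \<beta>F + e) - \<beta>F) \<bullet>
       ((transpose A ** A) *v (least_squares A (A *v \<beta>F + e) - \<beta>F))) / s\<^sup>2)"
    and "F2 = (\<lambda>(A :: real ^ 'p ^ 'k, e). ((least_squares A (A *v \<beta>F + e) - \<beta>F) \<bullet>
       ((transpose A ** A) *v (least_squares A (A *v \<beta>F + e) - \<beta>F)) / real p)
       / (SSR A (A *v \<beta>F + e) / real (k - p)))"
    and "F3 = (\<lambda>j (A :: real ^ 'p ^ 'k, e). (least_squares A (A *v \<beta>F + e) $ j - \<beta>F $ j) *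
       (SSR A (A *v \<beta>F + e) / real (k - p) * matrix_inv (transpose A ** A) $ j $ j) powr (- 1 / 2))"
  have "has_law M (\<lambda>\<omega>. F1 (S \<omega> ** X, S \<omega> *v r)) (chi_square_distribution p)"
  proof (rule sketch)
    show "F1 \<in> borel_measurable (borel \<Otimes>\<^sub>M borel)"
      unfolding F1_def by measurable
    show "distr std_gaussian borel (\<lambda>z. F1 (A, (norm r / sqrt (real CARD('k))) *\<^sub>R z)) = chi_square_distribution p"
      if "invertible (transpose A ** A)" for A
      using laws(1)[OF that] by (simp add: F1_def p_def s_def k_def)
  qed (simp add: chi_square_distribution_def)
  moreover have "has_law M (\<lambda>\<omega>. F2 (S \<omega> ** X, S \<omega> *v r)) (F_distribution p (k - p))"
  proof (rule sketch)
    show "F2 \<in> borel_measurable (borel \<Otimes>\<^sub>M borel)"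
      unfolding F2_def by measurable
    show "distr std_gaussian borel (\<lambda>z. F2 (A, (norm r / sqrt (real CARD('k))) *\<^sub>R z)) = F_distribution p (k - p)"
      if "invertible (transpose A ** A)" for A
      using laws(2)[OF that] by (simp add: F2_def p_def s_def k_def)
  qed (simp add: F_distribution_def)
  moreover have "has_law M (\<lambda>\<omega>. F3 j (S \<omega> ** X, S \<omega> *v r)) (t_distribution (k - p))" for j
  proof (rule sketch)
    show "F3 j \<in> borel_measurable (borel \<Otimes>\<^sub>M borel)"
      unfolding F3_def by measurable
    show "distr std_gaussian borel (\<lambda>z. F3 j (A, (norm r / sqrt (real CARD('k))) *\<^sub>R z)) = t_distribution (k - p)"
      if "invertible (transpose A ** A)" for A
      using laws(3)[OF that, of j] by (simp add: F3_def p_def s_def k_def)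
  qed (simp add: t_distribution_def)
  ultimately show ?thesis
    by (simp add: F1_def F2_def F3_def \<beta>s_def SSRs_def ys s2 Xs_def)
qed

end
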